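(* Let $m>0$ and let $\widetilde{\mathcal S}=\{F_j(y,y',\ldots,y^{(m)})=0\}_{1\le j\le M}$ be a finite system of autonomous algebraic ordinary differential equations in one unknown function $y=y(x)$, where $F_1,\ldots,F_M\in\mathbb{C}[y,y',\ldots,y^{(m)}]$, and assume that the algebraic set $\mathbb{V}_{\mathbb{C}}(\widetilde{\mathcal S})\subseteq\mathbb{C}^{m+1}$ has dimension one. Then every formal Puiseux series solution of $\widetilde{\mathcal S}$, expanded around a finite point $x_0\in\mathbb{C}$ or at infinity, is convergent.
   Context: $\mathbb{V}_{\mathbb{C}}(\widetilde{\mathcal S})$ is the set of common zeros in $\mathbb{C}^{m+1}$ of $F_1,\ldots,F_M$, where $y,y',\ldots,y^{(m)}$ are regarded as independent variables; having dimension one means that it is a finite union of (at least one) algebraic curves and, possibly, finitely many points. A formal Puiseux series expanded around $x_0\in\mathbb{C}$ is a series $\sum_{j\ge p}c_j(x-x_0)^{j/n}$ with $p\in\mathbb{Z}$, $n\in\mathbb{Z}_{>0}$, $c_j\in\mathbb{C}$; expanded at infinity it is a series $\sum_{j\ge p}c_j x^{-j/n}$. Derivation is term-by-term with respect to $x$. A solution of $\widetilde{\mathcal S}$ is such a series $y(x)$ with $F_j(y(x),y'(x),\ldots,y^{(m)}(x))=0$ for all $j$. It is convergent if, with $t=(x-x_0)^{1/n}$ (respectively $t=x^{-1/n}$), the Laurent series $\sum_{j\ge p}c_jt^j$ converges in some punctured neighborhood of $t=0$. *)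

theory Defs
  imports
    "HOL-Library.Poly_Mapping"
    "HOL-Library.Extended_Nat"
    "HOL-Library.FuncSet"
    "HOL-Complex_Analysis.Laurent_Convergence"
begin

section \<open>Multivariate polynomials and their zero sets\<close>

text \<open>
  Variables are numbered by \<^typ>\<open>nat\<close>; a polynomial in \<open>n\<close> variables is one with
  \<open>poly_vars F \<subseteq> {..<n}\<close>. For a differential polynomial, variable \<open>i\<close> stands for
  the \<open>i\<close>-th derivative of \<open>y\<close>.
\<close>

type_synonym complex_mpoly = "(nat \<Rightarrow>\<^sub>0 nat) \<Rightarrow>\<^sub>0 complex"

definition poly_vars :: "complex_mpoly \<Rightarrow> nat set" where
  "poly_vars F = (\<Union>\<mu>\<in>Poly_Mapping.keys F. Poly_Mapping.keys \<mu>)"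

text \<open>
  Evaluation in a commutative ring into which the coefficients are mapped by \<open>\<phi>\<close>;
  this is used for \<^typ>\<open>complex\<close> (with \<open>id\<close>) and for \<^typ>\<open>complex fls\<close> (with \<open>fls_const\<close>).
\<close>

definition poly_eval :: "(complex \<Rightarrow> 'a::comm_ring_1) \<Rightarrow> (nat \<Rightarrow> 'a) \<Rightarrow> complex_mpoly \<Rightarrow> 'a" where
  "poly_eval \<phi> v F =
     (\<Sum>\<mu>\<in>Poly_Mapping.keys F. \<phi> (Poly_Mapping.lookup F \<mu>) *
        (\<Prod>i\<in>Poly_Mapping.keys \<mu>. v i ^ Poly_Mapping.lookup \<mu> i))"

text \<open>Points of \<open>\<complex>\<^sup>n\<close> are functions on \<open>{..<n}\<close>, extended by \<^term>\<open>undefined\<close>.\<close>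

abbreviation affine_space :: "nat \<Rightarrow> (nat \<Rightarrow> complex) set" where
  "affine_space n \<equiv> {..<n} \<rightarrow>\<^sub>E UNIV"

definition zero_set :: "nat \<Rightarrow> complex_mpoly set \<Rightarrow> (nat \<Rightarrow> complex) set" where
  "zero_set n S = {a \<in> affine_space n. \<forall>F\<in>S. poly_eval id a F = 0}"

definition algebraic_set :: "nat \<Rightarrow> (nat \<Rightarrow> complex) set \<Rightarrow> bool" where
  "algebraic_set n V \<longleftrightarrow> (\<exists>S. (\<forall>F\<in>S. poly_vars F \<subseteq> {..<n}) \<and> V = zero_set n S)"

definition irreducible_algebraic_set :: "nat \<Rightarrow> (nat \<Rightarrow> complex) set \<Rightarrow> bool" where
  "irreducible_algebraic_set n V \<longleftrightarrow> algebraic_set n V \<and> V \<noteq> {} \<and>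
     (\<forall>A B. algebraic_set n A \<and> algebraic_set n B \<and> V = A \<union> B \<longrightarrow> V = A \<or> V = B)"

text \<open>
  Krull dimension: the supremum of the lengths \<open>k\<close> of strict chains
  \<open>Z\<^sub>0 \<subset> \<dots> \<subset> Z\<^sub>k\<close> of irreducible algebraic subsets. (The value for the empty set is
  0 instead of the usual \<open>-\<infinity>\<close>; irreducible sets are nonempty.)
\<close>

definition krull_dim :: "nat \<Rightarrow> (nat \<Rightarrow> complex) set \<Rightarrow> enat" where
  "krull_dim n V = Sup {enat k | k. \<exists>Z.
     (\<forall>i\<le>k. irreducible_algebraic_set n (Z i) \<and> Z i \<subseteq> V) \<and> (\<forall>i<k. Z i \<subset> Z (Suc i))}"

definition algebraic_curve :: "nat \<Rightarrow> (nat \<Rightarrow> complex) set \<Rightarrow> bool" where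
  "algebraic_curve n C \<longleftrightarrow> irreducible_algebraic_set n C \<and> krull_dim n C = 1"

definition dimension_one :: "nat \<Rightarrow> (nat \<Rightarrow> complex) set \<Rightarrow> bool" where
  "dimension_one n V \<longleftrightarrow>
     (\<exists>\<C> P. finite \<C> \<and> \<C> \<noteq> {} \<and> (\<forall>C\<in>\<C>. algebraic_curve n C) \<and>
            finite P \<and> P \<subseteq> affine_space n \<and> V = \<Union>\<C> \<union> P)"


section \<open>Formal Puiseux series\<close>

text \<open>
  A formal Puiseux series is given by its expansion point, a ramification \<open>n > 0\<close>, and the formal
  Laurent series \<open>f = \<Sum>c\<^sub>j t\<^sup>j\<close>, where \<open>t = (x - x\<^sub>0)\<^bsup>1/n\<^esup>\<close> at a finite point
  \<open>x\<^sub>0\<close> and \<open>t = x\<^bsup>-1/n\<^esup>\<close> at infinity. Sums and products of series with the same point and \<open>n\<close>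
  are those of \<^typ>\<open>complex fls\<close>.
\<close>

datatype expansion_point = Finite complex | Infinity

text \<open>
  The derivative with respect to \<open>x\<close>. The chain rule gives \<open>dt/dx = t\<^bsup>1-n\<^esup>/n\<close> at a finite point
  and \<open>dt/dx = -t\<^bsup>n+1\<^esup>/n\<close> at infinity; the two lemmas below show that this is
  term-by-term derivation. Note that \<open>fls_shift k\<close> divides by \<open>t\<^sup>k\<close>.
\<close>

fun puiseux_deriv :: "expansion_point \<Rightarrow> nat \<Rightarrow> complex fls \<Rightarrow> complex fls" where
  "puiseux_deriv (Finite x0) n f =
     fls_const (1 / of_nat n) * fls_shift (int n - 1) (fls_deriv f)"
| "puiseux_deriv Infinity n f =
     fls_const (- 1 / of_nat n) * fls_shift (- int n - 1) (fls_deriv f)"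

lemma puiseux_deriv_Finite_nth:
  "fls_nth (puiseux_deriv (Finite x0) n f) (j - int n) = of_int j / of_nat n * fls_nth f j"
  by (simp add: algebra_simps)

lemma puiseux_deriv_Infinity_nth:
  "fls_nth (puiseux_deriv Infinity n f) (j + int n) = - of_int j / of_nat n * fls_nth f j"
  by (simp add: algebra_simps)

definition puiseux_solution ::
  "nat \<Rightarrow> (nat \<Rightarrow> complex_mpoly) \<Rightarrow> expansion_point \<Rightarrow> nat \<Rightarrow> complex fls \<Rightarrow> bool" where
  "puiseux_solution M F p n f \<longleftrightarrow>
     (\<forall>j\<in>{1..M}. poly_eval fls_const (\<lambda>i. (puiseux_deriv p n ^^ i) f) (F j) = 0)"

definition laurent_convergent :: "complex fls \<Rightarrow> bool" where
  "laurent_convergent f \<longleftrightarrow> (\<exists>r>0. \<forall>t. 0 < norm t \<and> norm t < r \<longrightarrow>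
     summable (\<lambda>k. fls_nth f (fls_subdegree f + int k) * t powi (fls_subdegree f + int k)))"

lemma laurent_convergent_iff: "laurent_convergent f \<longleftrightarrow> fls_conv_radius f > 0"
proof -
  define d where "d = fls_subdegree f"
  define g where "g = (\<lambda>k. fls_nth f (d + int k))"
  have R: "fls_conv_radius f = conv_radius g"
    unfolding fls_conv_radius_altdef fps_conv_radius_def g_def d_def
    by (simp add: add.commute)
  have S: "summable (\<lambda>k. g k * t powi (d + int k)) \<longleftrightarrow> summable (\<lambda>k. g k * t ^ k)"
    if "t \<noteq> 0" for t
  proof -
    have "(\<lambda>k. g k * t powi (d + int k)) = (\<lambda>k. t powi d * (g k * t ^ k))"
      using that by (auto simp: power_int_add mult_ac)
    then show ?thesis using that by (simp add: summable_cmult_iff)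
  qed
  have "laurent_convergent f \<longleftrightarrow>
    (\<exists>r>0. \<forall>t. 0 < norm t \<and> norm t < r \<longrightarrow> summable (\<lambda>k. g k * t ^ k))"
  proof -
    have "(0 < norm t \<and> norm t < r \<longrightarrow> summable (\<lambda>k. g k * t powi (d + int k))) \<longleftrightarrow>
          (0 < norm t \<and> norm t < r \<longrightarrow> summable (\<lambda>k. g k * t ^ k))" for r t
      using S[of t] by (cases "t = 0") simp_all
    moreover have "fls_nth f (d + int k) = g k" for k by (simp add: g_def)
    ultimately show ?thesis
      unfolding laurent_convergent_def d_def[symmetric] by (simp only:)
  qed
  also have "\<dots> \<longleftrightarrow> conv_radius g > 0"
  proof (intro iffI; (elim exE conjE)?)
    fix r :: real
    assume r: "0 < r" "\<forall>t. 0 < norm t \<and> norm t < r \<longrightarrow> summable (\<lambda>k. g k * t ^ k)"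
    define z where "z = complex_of_real (r / 2)"
    have z: "norm z = r / 2" using r(1) by (simp add: z_def)
    have "summable (\<lambda>k. g k * z ^ k)"
      by (rule r(2)[rule_format]) (simp only: z, use r(1) in simp)
    then have "ereal (norm z) \<le> conv_radius g" by (rule conv_radius_geI)
    then have "ereal (r / 2) \<le> conv_radius g" by (simp only: z)
    moreover have "(0::ereal) < ereal (r/2)" using r(1) by simp
    ultimately show "conv_radius g > 0" by (rule less_le_trans[rotated])
  next
    assume "conv_radius g > 0"
    then obtain r where r: "0 < ereal r" "ereal r < conv_radius g"
      using ereal_dense2 by blast
    have "summable (\<lambda>k. g k * t ^ k)" if "norm t < r" for t
    proof (rule summable_in_conv_radius)
      have "ereal (norm t) < ereal r" using that by simp
      then show "ereal (norm t) < conv_radius g" using r(2) by (rule less_trans)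
    qed
    with r(1) show "\<exists>r>0. \<forall>t. 0 < norm t \<and> norm t < r \<longrightarrow> summable (\<lambda>k. g k * t ^ k)"
      by (intro exI[of _ r]) simp
  qed
  finally show ?thesis unfolding R .
qed

end

theory Submission
  imports Defs
begin

text \<open>
  Let \<open>D\<close> be the derivation of Laurent series in \<open>t\<close> induced by \<open>d/dx\<close> and \<open>f\<close> a nonconstant
  solution. Write \<open>f = c + s\<^sup>k\<close> with a power series \<open>s\<close> of order one, and let \<open>T\<close> be its compositional
  inverse, so that \<open>f \<circ> T = c + X\<^sup>k\<close> converges. Let \<open>P\<close> be the prime ideal of polynomials vanishing at
  \<open>(f, D f, D\<^sup>2 f, \<dots>)\<close>. If \<open>D f \<circ> T\<close> were not algebraic over the convergent series, some prime ideal
  containing \<open>P\<close> and a polynomial \<open>y' - c\<close> would contain no polynomial \<open>y - a\<close>, and the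
  Nullstellensatz would give a chain point \<open>\<subset>\<close> curve \<open>\<subset>\<close> zero set of \<open>P\<close> inside one of the given
  curves. As the field is uncountable, both steps reduce to the linear dependence of uncountable
  families of polynomials.

  Hence \<open>D f \<circ> T\<close> is algebraic over the convergent series and therefore converges. The chain rule
  expresses the derivative of \<open>T\<^sup>n\<close> (of \<open>T\<close> to the power \<open>-n\<close> at infinity) by \<open>D f \<circ> T\<close>, so \<open>T\<close>,
  \<open>s\<close> and \<open>f\<close> converge.
\<close>

section \<open>Evaluation of polynomials\<close>

definition mconst :: "complex \<Rightarrow> complex_mpoly" where
  "mconst c = Poly_Mapping.single 0 c"

definition mvar :: "nat \<Rightarrow> complex_mpoly" where
  "mvar i = Poly_Mapping.single (Poly_Mapping.single i 1) 1"

definition monomial_eval :: "(nat \<Rightarrow> 'a::comm_ring_1) \<Rightarrow> (nat \<Rightarrow>\<^sub>0 nat) \<Rightarrow> 'a" where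
  "monomial_eval v \<mu> = (\<Prod>i\<in>Poly_Mapping.keys \<mu>. v i ^ Poly_Mapping.lookup \<mu> i)"

lemma monomial_eval_superset:
  assumes "finite A" "Poly_Mapping.keys \<mu> \<subseteq> A"
  shows "monomial_eval v \<mu> = (\<Prod>i\<in>A. v i ^ Poly_Mapping.lookup \<mu> i)"
  unfolding monomial_eval_def
  by (rule prod.mono_neutral_left) (use assms in \<open>auto simp: not_in_keys_iff_lookup_eq_zero\<close>)

lemma monomial_eval_add: "monomial_eval v (\<mu> + \<nu>) = monomial_eval v \<mu> * monomial_eval v \<nu>"
proof -
  define A where "A = Poly_Mapping.keys \<mu> \<union> Poly_Mapping.keys \<nu>"
  have A: "finite A" "Poly_Mapping.keys \<mu> \<subseteq> A" "Poly_Mapping.keys \<nu> \<subseteq> A"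
    "Poly_Mapping.keys (\<mu> + \<nu>) \<subseteq> A"
    using keys_add[of \<mu> \<nu>] by (auto simp: A_def)
  show ?thesis
    by (simp add: A monomial_eval_superset[of A] lookup_add power_add prod.distrib)
qed

lemma mpoly_sum_monomials:
  "F = (\<Sum>\<mu>\<in>Poly_Mapping.keys F. Poly_Mapping.single \<mu> (Poly_Mapping.lookup F \<mu>))"
proof (rule poly_mapping_eqI)
  fix k
  have "Poly_Mapping.lookup (\<Sum>\<mu>\<in>Poly_Mapping.keys F. Poly_Mapping.single \<mu> (Poly_Mapping.lookup F \<mu>)) k
     = (\<Sum>\<mu>\<in>Poly_Mapping.keys F. if \<mu> = k then Poly_Mapping.lookup F \<mu> else 0)"
    by (auto simp: lookup_sum lookup_single when_def intro!: sum.cong)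
  also have "\<dots> = Poly_Mapping.lookup F k"
    by (simp add: sum.delta not_in_keys_iff_lookup_eq_zero)
  finally show "Poly_Mapping.lookup F k = Poly_Mapping.lookup
    (\<Sum>\<mu>\<in>Poly_Mapping.keys F. Poly_Mapping.single \<mu> (Poly_Mapping.lookup F \<mu>)) k" by simp
qed

text \<open>Three instances serve the proof: \<open>id\<close> evaluates at points,
  \<open>fls_const\<close> at tuples of Laurent series, and \<open>mconst\<close> substitutes a
  polynomial into a univariate complex polynomial.\<close>

locale coefficient_map =
  fixes \<phi> :: "complex \<Rightarrow> 'a::comm_ring_1"
  assumes map_1: "\<phi> 1 = 1" and map_add: "\<phi> (a + b) = \<phi> a + \<phi> b"
    and map_mult: "\<phi> (a * b) = \<phi> a * \<phi> b"
begin

lemma map_0: "\<phi> 0 = 0"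
  using map_add[of 0 0] by simp

lemma poly_eval_superset:
  assumes "finite A" "Poly_Mapping.keys F \<subseteq> A"
  shows "poly_eval \<phi> v F = (\<Sum>\<mu>\<in>A. \<phi> (Poly_Mapping.lookup F \<mu>) * monomial_eval v \<mu>)"
  unfolding poly_eval_def monomial_eval_def
  by (rule sum.mono_neutral_left)
     (use assms in \<open>auto simp: not_in_keys_iff_lookup_eq_zero map_0\<close>)

lemma poly_eval_add: "poly_eval \<phi> v (F + G) = poly_eval \<phi> v F + poly_eval \<phi> v G"
proof -
  define A where "A = Poly_Mapping.keys F \<union> Poly_Mapping.keys G"
  have A: "finite A" "Poly_Mapping.keys F \<subseteq> A" "Poly_Mapping.keys G \<subseteq> A"
    "Poly_Mapping.keys (F + G) \<subseteq> A"
    using keys_add[of F G] by (auto simp: A_def)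
  show ?thesis
    by (simp add: A poly_eval_superset[of A] lookup_add map_add distrib_right sum.distrib)
qed

lemma poly_eval_0: "poly_eval \<phi> v 0 = 0"
  by (simp add: poly_eval_def)

lemma poly_eval_sum: "poly_eval \<phi> v (\<Sum>i\<in>A. F i) = (\<Sum>i\<in>A. poly_eval \<phi> v (F i))"
  by (induction A rule: infinite_finite_induct) (simp_all add: poly_eval_0 poly_eval_add)

lemma poly_eval_single: "poly_eval \<phi> v (Poly_Mapping.single \<mu> c) = \<phi> c * monomial_eval v \<mu>"
  by (subst poly_eval_superset[of "{\<mu>}"]) (auto simp: lookup_single)

lemma poly_eval_mult: "poly_eval \<phi> v (F * G) = poly_eval \<phi> v F * poly_eval \<phi> v G"
proof -
  have *: "poly_eval \<phi> v (Poly_Mapping.single \<mu> a * Poly_Mapping.single \<nu> b) =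
      poly_eval \<phi> v (Poly_Mapping.single \<mu> a) * poly_eval \<phi> v (Poly_Mapping.single \<nu> b)" for \<mu> \<nu> a b
    by (simp add: mult_single poly_eval_single monomial_eval_add map_mult mult_ac)
  define f g where "f = (\<lambda>\<mu>. Poly_Mapping.single \<mu> (Poly_Mapping.lookup F \<mu>))"
    and "g = (\<lambda>\<nu>. Poly_Mapping.single \<nu> (Poly_Mapping.lookup G \<nu>))"
  have "F = sum f (Poly_Mapping.keys F)" "G = sum g (Poly_Mapping.keys G)"
    unfolding f_def g_def by (rule mpoly_sum_monomials)+
  moreover have "poly_eval \<phi> v (sum f A * sum g B) =
      poly_eval \<phi> v (sum f A) * poly_eval \<phi> v (sum g B)" for A B
    unfolding sum_product poly_eval_sum by (simp only: f_def g_def *)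
  ultimately show ?thesis by metis
qed

lemma poly_eval_mconst: "poly_eval \<phi> v (mconst c) = \<phi> c"
  by (simp add: mconst_def poly_eval_single monomial_eval_def)

lemma poly_eval_mvar: "poly_eval \<phi> v (mvar i) = v i"
  by (simp add: mvar_def poly_eval_single monomial_eval_def map_1)

lemma poly_eval_1: "poly_eval \<phi> v 1 = 1"
  using poly_eval_mconst[of v 1] by (simp add: mconst_def map_1 flip: single_one)

lemma poly_eval_diff: "poly_eval \<phi> v (F - G) = poly_eval \<phi> v F - poly_eval \<phi> v G"
  using poly_eval_add[of v "F - G" G] by (simp add: algebra_simps)

lemma poly_eval_prod: "poly_eval \<phi> v (\<Prod>i\<in>A. F i) = (\<Prod>i\<in>A. poly_eval \<phi> v (F i))"
  by (induction A rule: infinite_finite_induct) (simp_all add: poly_eval_1 poly_eval_mult)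

end

interpretation eval_id: coefficient_map "id :: complex \<Rightarrow> complex"
  by unfold_locales auto

interpretation mconst: coefficient_map mconst
  by unfold_locales (simp_all add: mconst_def single_add mult_single flip: single_one)

lemma mconst_diff: "mconst (a - b) = mconst a - mconst b"
  by (simp add: mconst_def single_diff)

lemma poly_vars_mvar_diff_mconst: "poly_vars (mvar i - mconst c) \<subseteq> {i}"
proof -
  have "Poly_Mapping.keys (mvar i - mconst c) \<subseteq> {Poly_Mapping.single i 1, 0}"
    by (auto simp: mvar_def mconst_def in_keys_iff lookup_minus lookup_single when_def split: if_splits)
  then show ?thesis unfolding poly_vars_def
    by (auto simp: in_keys_iff lookup_single when_def split: if_splits)
qed

lemma poly_eval_cong_vars:
  assumes "poly_vars F \<subseteq> A" "\<And>i. i \<in> A \<Longrightarrow> v i = w i"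
  shows "poly_eval \<phi> v F = poly_eval \<phi> w F"
proof -
  have "v i = w i" if "\<mu> \<in> Poly_Mapping.keys F" "i \<in> Poly_Mapping.keys \<mu>" for \<mu> i
    using assms that by (auto simp: poly_vars_def)
  then show ?thesis unfolding poly_eval_def by (intro sum.cong arg_cong2[of _ _ _ _ "(*)"] prod.cong) auto
qed

text \<open>Every polynomial arises from constants and variables by sums and products. Hence two
  ring homomorphisms need comparing only on those, be it reduction modulo an ideal or composition of
  series.\<close>

lemma mpoly_induct [case_names const var add mult]:
  assumes const: "\<And>c. P (mconst c)" and var: "\<And>i. P (mvar i)"
    and add: "\<And>F G. P F \<Longrightarrow> P G \<Longrightarrow> P (F + G)" and mult: "\<And>F G. P F \<Longrightarrow> P G \<Longrightarrow> P (F * G)"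
  shows "P F"
proof -
  have P1: "P 1" using const[of 1] by (simp add: mconst.map_1)
  have pw: "P (G ^ k)" if "P G" for G k
    by (induction k) (use P1 mult that in auto)
  have mvar_pow: "mvar i ^ k = Poly_Mapping.single (Poly_Mapping.single i k) 1" for i k
    by (induction k) (simp_all add: mvar_def mult_single flip: single_add)
  have mono: "P (Poly_Mapping.single \<mu> (1::complex))" for \<mu>
  proof (induction \<mu> rule: update_induct)
    case const
    then show ?case using P1 by simp
  next
    case (update f a b)
    \<comment> \<open>The variable \<open>a\<close> is absent from \<open>f\<close>, so setting its
      exponent to \<open>b\<close> multiplies the monomial by \<open>mvar a ^ b\<close>.\<close>
    have "Poly_Mapping.update a b f = f + Poly_Mapping.single a b"
      using update by (intro poly_mapping_eqI)
        (auto simp: lookup_update lookup_add lookup_single in_keys_iff)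
    then have "Poly_Mapping.single (Poly_Mapping.update a b f) (1::complex) =
        Poly_Mapping.single f 1 * mvar a ^ b"
      by (simp add: mvar_pow mult_single)
    then show ?case using mult[OF update.IH pw[OF var]] by simp
  qed
  have single: "P (Poly_Mapping.single \<mu> c)" for \<mu> c
    using mult[OF const[of c] mono[of \<mu>]] by (simp add: mconst_def mult_single)
  have "P (\<Sum>\<mu>\<in>A. Poly_Mapping.single \<mu> (Poly_Mapping.lookup F \<mu>))" for A
    by (induction A rule: infinite_finite_induct) (use const[of 0] add single in \<open>auto simp: mconst.map_0\<close>)
  then show ?thesis by (subst mpoly_sum_monomials)
qed

section \<open>Prime ideals\<close>

definition ideal :: "'a::comm_ring_1 set \<Rightarrow> bool" where
  "ideal I \<longleftrightarrow> 0 \<in> I \<and> (\<forall>a\<in>I. \<forall>b\<in>I. a + b \<in> I) \<and> (\<forall>a\<in>I. \<forall>r. r * a \<in> I)"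

definition prime_ideal :: "'a::comm_ring_1 set \<Rightarrow> bool" where
  "prime_ideal I \<longleftrightarrow> ideal I \<and> 1 \<notin> I \<and> (\<forall>a b. a * b \<in> I \<longrightarrow> a \<in> I \<or> b \<in> I)"

lemma ideal_0: "ideal I \<Longrightarrow> 0 \<in> I"
  and ideal_add: "ideal I \<Longrightarrow> a \<in> I \<Longrightarrow> b \<in> I \<Longrightarrow> a + b \<in> I"
  and ideal_mult: "ideal I \<Longrightarrow> a \<in> I \<Longrightarrow> r * a \<in> I"
  by (auto simp: ideal_def)

lemma ideal_mult_right: "ideal I \<Longrightarrow> a \<in> I \<Longrightarrow> a * r \<in> I"
  using ideal_mult[of I a r] by (simp add: mult.commute)

lemma ideal_uminus: "ideal I \<Longrightarrow> a \<in> I \<Longrightarrow> - a \<in> I"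
  using ideal_mult[of I a "-1"] by simp

lemma ideal_diff: "ideal I \<Longrightarrow> a \<in> I \<Longrightarrow> b \<in> I \<Longrightarrow> a - b \<in> I"
  using ideal_add[of I a "-b"] ideal_uminus[of I b] by simp

lemma ideal_sum: "ideal I \<Longrightarrow> (\<And>i. i \<in> A \<Longrightarrow> f i \<in> I) \<Longrightarrow> sum f A \<in> I"
  by (induction A rule: infinite_finite_induct) (auto simp: ideal_0 ideal_add)

lemma ideal_adjoin:
  assumes "ideal I"
  shows "ideal {q + b * h | q b. q \<in> I}"
  unfolding ideal_def
proof (intro conjI ballI allI)
  show "0 \<in> {q + b * h |q b. q \<in> I}"
    using ideal_0[OF assms] by (auto intro!: exI[of _ 0])
next
  fix x y assume "x \<in> {q + b * h |q b. q \<in> I}" "y \<in> {q + b * h |q b. q \<in> I}"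
  then obtain q b q' b' where "x = q + b * h" "y = q' + b' * h" "q \<in> I" "q' \<in> I" by auto
  then have "x + y = (q + q') + (b + b') * h" "q + q' \<in> I"
    using ideal_add[OF assms, of q q'] by (simp_all add: algebra_simps)
  then show "x + y \<in> {q + b * h |q b. q \<in> I}" by blast
next
  fix x r assume "x \<in> {q + b * h |q b. q \<in> I}"
  then obtain q b where "x = q + b * h" "q \<in> I" by auto
  then have "r * x = r * q + (r * b) * h" "r * q \<in> I"
    using ideal_mult[OF assms, of q r] by (simp_all add: algebra_simps)
  then show "r * x \<in> {q + b * h |q b. q \<in> I}" by blast
qed

lemma prime_ideal_prod:
  assumes "prime_ideal I" "finite A" "\<And>i. i \<in> A \<Longrightarrow> f i \<notin> I"
  shows "prod f A \<notin> I"
  using assms(2,3) by (induction A) (use assms(1) in \<open>auto simp: prime_ideal_def\<close>)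

lemma prime_ideal_power:
  assumes "prime_ideal I" "u \<notin> I"
  shows "u ^ k \<notin> I"
  by (induction k) (use assms in \<open>auto simp: prime_ideal_def\<close>)

text \<open>Zorn's lemma gives an ideal maximal among those that contain \<open>I\<close> and miss
  the multiplicative set \<open>S\<close>; it is prime. The last clause records the maximality:
  whatever lies outside \<open>J\<close> divides an element of \<open>S\<close> modulo
  \<open>J\<close>.\<close>

lemma exists_prime_ideal_avoiding:
  assumes I: "ideal I" and S: "1 \<in> S" "\<And>s t. s \<in> S \<Longrightarrow> t \<in> S \<Longrightarrow> s * t \<in> S" and IS: "I \<inter> S = {}"
  obtains J where "prime_ideal J" "I \<subseteq> J" "J \<inter> S = {}"
    "\<forall>h. h \<notin> J \<longrightarrow> (\<exists>b. \<exists>s\<in>S. b * h - s \<in> J)"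
proof -
  define \<A> where "\<A> = {J. ideal J \<and> I \<subseteq> J \<and> J \<inter> S = {}}"
  have "\<Union>\<C> \<in> \<A>" if C: "\<C> \<noteq> {}" "subset.chain \<A> \<C>" for \<C>
  proof -
    have sub: "\<C> \<subseteq> \<A>" using C(2) by (auto simp: subset.chain_def)
    have tot: "J \<subseteq> K \<or> K \<subseteq> J" if "J \<in> \<C>" "K \<in> \<C>" for J K
      using C(2) that by (auto simp: subset_chain_def)
    have "ideal (\<Union>\<C>)"
      unfolding ideal_def
    proof (intro conjI ballI allI)
      show "0 \<in> \<Union>\<C>" using C(1) sub ideal_0 unfolding \<A>_def by blast
    next
      fix a b assume "a \<in> \<Union>\<C>" "b \<in> \<Union>\<C>"
      then obtain J K where JK: "a \<in> J" "b \<in> K" "J \<in> \<C>" "K \<in> \<C>" by blast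
      then obtain L where "a \<in> L" "b \<in> L" "L \<in> \<C>" using tot[of J K] by blast
      then show "a + b \<in> \<Union>\<C>" using sub ideal_add unfolding \<A>_def by blast
    next
      fix a r assume "a \<in> \<Union>\<C>"
      then show "r * a \<in> \<Union>\<C>" using sub ideal_mult unfolding \<A>_def by blast
    qed
    then show ?thesis using C(1) sub by (auto simp: \<A>_def)
  qed
  moreover have "\<A> \<noteq> {}" using I IS by (auto simp: \<A>_def)
  ultimately obtain J where "J \<in> \<A>" and max: "\<And>K. K \<in> \<A> \<Longrightarrow> J \<subseteq> K \<Longrightarrow> K = J"
    using subset_Zorn_nonempty[of \<A>] by metis
  then have J: "ideal J" "I \<subseteq> J" "J \<inter> S = {}" by (auto simp: \<A>_def)
  have ex: "\<exists>b. \<exists>s\<in>S. b * h - s \<in> J" if h: "h \<notin> J" for h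
  proof -
    \<comment> \<open>The ideal generated by \<open>J\<close> and \<open>h\<close> is strictly
      larger than \<open>J\<close>, so it has to meet \<open>S\<close>.\<close>
    define K where "K = {q + b * h | q b. q \<in> J}"
    have K: "q + b * h \<in> K" if "q \<in> J" for q b using that unfolding K_def by blast
    have "J \<subseteq> K" using K[of _ 0] by auto
    moreover have "h \<in> K" using K[OF ideal_0[OF J(1)], of 1] by simp
    ultimately have "K \<notin> \<A>" using max[of K] h by blast
    with \<open>J \<subseteq> K\<close> J ideal_adjoin[OF J(1), of h] have "K \<inter> S \<noteq> {}"
      unfolding \<A>_def K_def[symmetric] by blast
    then obtain q b where qb: "q \<in> J" "q + b * h \<in> S" unfolding K_def by blast
    have "b * h - (q + b * h) \<in> J" using ideal_uminus[OF J(1) qb(1)] by simp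
    with qb(2) show ?thesis by blast
  qed
  have "prime_ideal J"
    unfolding prime_ideal_def
  proof (intro conjI allI impI J(1))
    show "1 \<notin> J" using J(3) S(1) by blast
  next
    fix x y assume xy: "x * y \<in> J"
    show "x \<in> J \<or> y \<in> J"
    proof (rule ccontr)
      assume "\<not> (x \<in> J \<or> y \<in> J)"
      with ex obtain b s c t where st: "s \<in> S" "t \<in> S" "b * x - s \<in> J" "c * y - t \<in> J" by blast
      \<comment> \<open>Modulo \<open>J\<close>, \<open>s\<close> is \<open>b * x\<close> and
        \<open>t\<close> is \<open>c * y\<close>, so \<open>s * t\<close> is a multiple of
        \<open>x * y\<close> there.\<close>
      have "s * t = b * c * (x * y) - (b * x - s) * (c * y) - s * (c * y - t)"
        by (simp add: algebra_simps)
      also have "\<dots> \<in> J"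
        by (intro ideal_diff[OF J(1)] ideal_mult[OF J(1)] ideal_mult_right[OF J(1)] xy st)
      finally show False using S(2)[OF st(1,2)] J(3) by blast
    qed
  qed
  then show thesis using that J(2,3) ex by blast
qed

section \<open>Hilbert's Nullstellensatz over an uncountable field\<close>

text \<open>Gaussian elimination, one coordinate in \<open>K\<close> at a time. The vectors form an
  indexed family, so repetitions count as dependencies.\<close>

lemma infinite_family_dependent:
  fixes b :: "'i \<Rightarrow> 'k \<Rightarrow> 'f::field"
  assumes "finite K" "infinite I"
  shows "\<exists>B l. finite B \<and> B \<subseteq> I \<and> (\<exists>i\<in>B. l i \<noteq> 0) \<and> (\<forall>k\<in>K. (\<Sum>i\<in>B. l i * b i k) = 0)"
  using assms
proof (induction K arbitrary: I b rule: finite_induct)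
  case empty
  then have "I \<noteq> {}" by auto
  then obtain i where "i \<in> I" by blast
  then show ?case by (intro exI[of _ "{i}"] exI[of _ "\<lambda>_. 1"]) simp
next
  case (insert k K)
  show ?case
  proof (cases "\<exists>i\<in>I. b i k \<noteq> 0")
    case False
    obtain B l where B: "finite B" "B \<subseteq> I" "\<exists>i\<in>B. l i \<noteq> 0"
      "\<forall>k\<in>K. (\<Sum>i\<in>B. l i * b i k) = 0"
      using insert.IH[OF insert.prems, of b] by (elim exE conjE)
    have "(\<Sum>i\<in>B. l i * b i k) = 0"
      using False B(2) by (intro sum.neutral) auto
    with B(4) have "\<forall>j\<in>insert k K. (\<Sum>i\<in>B. l i * b i j) = 0" by simp
    then show ?thesis using B(1-3) by (intro exI conjI)
  next
    case True
    then obtain i0 where i0: "i0 \<in> I" "b i0 k \<noteq> 0" by blast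
    \<comment> \<open>The pivot \<open>b i0\<close> clears coordinate \<open>k\<close> of all the
      other vectors.\<close>
    define b' where "b' = (\<lambda>i j. b i j - b i k / b i0 k * b i0 j)"
    have inf: "infinite (I - {i0})" using insert.prems by simp
    obtain B l where B: "finite B" "B \<subseteq> I - {i0}" "\<exists>i\<in>B. l i \<noteq> 0"
      "\<forall>j\<in>K. (\<Sum>i\<in>B. l i * b' i j) = 0"
      using insert.IH[OF inf, of b'] by (elim exE conjE)
    \<comment> \<open>The pivot's coefficient collects the multiples that were subtracted, so that
      both combinations agree in every coordinate.\<close>
    define l' where "l' = l(i0 := - (\<Sum>i\<in>B. l i * b i k) / b i0 k)"
    have eq: "(\<Sum>i\<in>insert i0 B. l' i * b i j) = (\<Sum>i\<in>B. l i * b' i j)" for j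
    proof -
      have "(\<Sum>i\<in>insert i0 B. l' i * b i j) = l' i0 * b i0 j + (\<Sum>i\<in>B. l' i * b i j)"
        using B(1,2) by (subst sum.insert) auto
      also have "(\<Sum>i\<in>B. l' i * b i j) = (\<Sum>i\<in>B. l i * b i j)"
        using B(2) by (intro sum.cong) (auto simp: l'_def)
      also have "l' i0 * b i0 j = - ((\<Sum>i\<in>B. l i * b i k) * (b i0 j / b i0 k))"
        by (simp add: l'_def)
      also have "(\<Sum>i\<in>B. l i * b i k) * (b i0 j / b i0 k) =
          (\<Sum>i\<in>B. l i * (b i k / b i0 k * b i0 j))"
        unfolding sum_distrib_right by (rule sum.cong) simp_all
      finally show ?thesis unfolding b'_def right_diff_distrib sum_subtractf by simp
    qed
    have "(\<Sum>i\<in>B. l i * b' i k) = 0"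
      using i0(2) by (intro sum.neutral) (simp add: b'_def)
    with B(4) have "\<forall>j\<in>insert k K. (\<Sum>i\<in>insert i0 B. l' i * b i j) = 0"
      unfolding eq by simp
    moreover have "\<exists>i\<in>insert i0 B. l' i \<noteq> 0" using B(2,3) by (auto simp: l'_def)
    moreover have "finite (insert i0 B)" "insert i0 B \<subseteq> I" using B(1,2) i0(1) by auto
    ultimately show ?thesis by (intro exI conjI)
  qed
qed

lemma uncountable_fibre:
  fixes f :: "'a \<Rightarrow> 'b::countable"
  assumes "uncountable A"
  obtains y where "uncountable {x \<in> A. f x = y}"
proof (rule ccontr)
  assume "\<not> thesis"
  then have "countable (\<Union>y. {x \<in> A. f x = y})" using that by (intro countable_UN) auto
  moreover have "(\<Union>y. {x \<in> A. f x = y}) = A" by auto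
  ultimately show False using assms by simp
qed

lemma countable_monomials: "countable (UNIV :: (nat \<Rightarrow>\<^sub>0 nat) set)"
proof -
  \<comment> \<open>Here \<open>Poly_Mapping.degree\<close> is a bound on the indices of the
    variables, not the total degree: exponents from that index on are zero, so the finite list
    determines the monomial.\<close>
  have "inj (\<lambda>\<mu> :: nat \<Rightarrow>\<^sub>0 nat. map (Poly_Mapping.lookup \<mu>) [0..<Poly_Mapping.degree \<mu>])"
  proof (rule injI)
    fix \<mu> \<nu> :: "nat \<Rightarrow>\<^sub>0 nat"
    assume eq: "map (Poly_Mapping.lookup \<mu>) [0..<Poly_Mapping.degree \<mu>] =
      map (Poly_Mapping.lookup \<nu>) [0..<Poly_Mapping.degree \<nu>]"
    then have deg: "Poly_Mapping.degree \<mu> = Poly_Mapping.degree \<nu>"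
      by (metis length_map length_upt diff_zero)
    show "\<mu> = \<nu>"
    proof (rule poly_mapping_eqI)
      fix k
      show "Poly_Mapping.lookup \<mu> k = Poly_Mapping.lookup \<nu> k"
      proof (cases "k < Poly_Mapping.degree \<mu>")
        case True
        then have "map (Poly_Mapping.lookup \<mu>) [0..<Poly_Mapping.degree \<mu>] ! k =
            map (Poly_Mapping.lookup \<nu>) [0..<Poly_Mapping.degree \<nu>] ! k" using eq by simp
        then show ?thesis using True deg by simp
      next
        case False
        then show ?thesis using deg by (simp add: beyond_degree_lookup_zero)
      qed
    qed
  qed
  then show ?thesis by (rule countableI')
qed

text \<open>There are only countably many finite sets of monomials, so infinitely many members of
  the family share one support and lie in a space of finite dimension.\<close>

lemma uncountable_mpolys_dependent:
  fixes b :: "'i \<Rightarrow> complex_mpoly"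
  assumes "uncountable A"
  obtains B l where "finite B" "B \<subseteq> A" "\<exists>c\<in>B. l c \<noteq> 0" "(\<Sum>c\<in>B. mconst (l c) * b c) = 0"
proof -
  define \<K> where "\<K> = (\<lambda>c. Poly_Mapping.keys (b c)) ` A"
  have "\<K> \<subseteq> {K. finite K \<and> K \<subseteq> UNIV}" by (auto simp: \<K>_def)
  then have cK: "countable \<K>"
    using countable_Collect_finite_subset[OF countable_monomials] countable_subset by blast
  obtain K where K: "K \<in> \<K>" "infinite {c \<in> A. Poly_Mapping.keys (b c) = K}"
  proof (rule ccontr)
    assume "\<not> thesis"
    then have "countable (\<Union>K\<in>\<K>. {c \<in> A. Poly_Mapping.keys (b c) = K})"
      using that cK by (intro countable_UN) (auto intro: countable_finite)
    moreover have "(\<Union>K\<in>\<K>. {c \<in> A. Poly_Mapping.keys (b c) = K}) = A" by (auto simp: \<K>_def)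
    ultimately show False using assms by simp
  qed
  have finK: "finite K" using K(1) by (auto simp: \<K>_def)
  obtain B l where B: "finite B" "B \<subseteq> {c \<in> A. Poly_Mapping.keys (b c) = K}" "\<exists>c\<in>B. l c \<noteq> 0"
    "\<forall>k\<in>K. (\<Sum>c\<in>B. l c * Poly_Mapping.lookup (b c) k) = 0"
    using infinite_family_dependent[OF finK K(2), of "\<lambda>c. Poly_Mapping.lookup (b c)"]
    by (elim exE conjE)
  have "Poly_Mapping.lookup (mconst a * F) k = a * Poly_Mapping.lookup F k" for a F k
    unfolding mconst_def by (simp flip: mult_map_scale_conv_mult add: map.rep_eq when_def)
  then have "(\<Sum>c\<in>B. mconst (l c) * b c) = 0"
  proof (intro poly_mapping_eqI)
    fix k
    assume *: "\<And>a F k. Poly_Mapping.lookup (mconst a * F) k = a * Poly_Mapping.lookup F k"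
    show "Poly_Mapping.lookup (\<Sum>c\<in>B. mconst (l c) * b c) k = Poly_Mapping.lookup 0 k"
    proof (cases "k \<in> K")
      case True
      then show ?thesis using B(4) by (simp add: lookup_sum *)
    next
      case False
      then have "Poly_Mapping.lookup (b c) k = 0" if "c \<in> B" for c
        using that B(2) by (auto simp: in_keys_iff)
      then show ?thesis by (simp add: lookup_sum *)
    qed
  qed
  then show thesis using that[of B l] B by auto
qed

text \<open>Modulo \<open>Q\<close>, \<open>b c\<close> acts as the fraction
  \<open>s c / (h - c)\<close>. Uncountably many such fractions are linearly dependent, and
  multiplying by the product of all \<open>h - k\<close> clears the denominators.\<close>

lemma uncountable_quotients_relation:
  assumes Q: "ideal Q" and A: "uncountable A"
    and rel: "\<And>c. c \<in> A \<Longrightarrow> b c * (h - mconst c) - s c \<in> Q"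
  obtains B l where "finite B" "B \<subseteq> A" "\<exists>c\<in>B. l c \<noteq> 0"
    "(\<Sum>c\<in>B. mconst (l c) * s c * (\<Prod>k\<in>B - {c}. h - mconst k)) \<in> Q"
proof -
  obtain B l where B: "finite B" "B \<subseteq> A" "\<exists>c\<in>B. l c \<noteq> 0" "(\<Sum>c\<in>B. mconst (l c) * b c) = 0"
    using uncountable_mpolys_dependent[OF A] by blast
  define \<pi> where "\<pi> = (\<lambda>c. \<Prod>k\<in>B - {c}. h - mconst k)"
  have "(\<Sum>c\<in>B. mconst (l c) * \<pi> c * (b c * (h - mconst c) - s c)) \<in> Q"
    by (intro ideal_sum[OF Q] ideal_mult[OF Q] rel) (use B in auto)
  also have "(\<Sum>c\<in>B. mconst (l c) * \<pi> c * (b c * (h - mconst c) - s c)) =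
      (\<Sum>c\<in>B. mconst (l c) * b c * (\<Prod>k\<in>B. h - mconst k)) - (\<Sum>c\<in>B. mconst (l c) * s c * \<pi> c)"
    unfolding sum_subtractf[symmetric]
  proof (rule sum.cong[OF refl])
    fix c assume "c \<in> B"
    then have \<pi>: "(\<Prod>k\<in>B. h - mconst k) = (h - mconst c) * \<pi> c"
      unfolding \<pi>_def using B(1) by (simp add: prod.remove)
    show "mconst (l c) * \<pi> c * (b c * (h - mconst c) - s c) =
      mconst (l c) * b c * (\<Prod>k\<in>B. h - mconst k) - mconst (l c) * s c * \<pi> c"
      unfolding \<pi> by (simp add: algebra_simps)
  qed
  also have "(\<Sum>c\<in>B. mconst (l c) * b c * (\<Prod>k\<in>B. h - mconst k)) = 0"
    using B(4) by (simp flip: sum_distrib_right)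
  finally have "(\<Sum>c\<in>B. mconst (l c) * s c * \<pi> c) \<in> Q"
    using ideal_uminus[OF Q] by fastforce
  then show thesis using that[of B l] B by (simp add: \<pi>_def)
qed

section \<open>Univariate complex polynomials evaluated through a coefficient map\<close>

context coefficient_map
begin

lemma map_poly_pCons_eval:
  "poly (map_poly \<phi> (pCons a p)) h = \<phi> a + h * poly (map_poly \<phi> p) h"
  by (simp add: map_poly_pCons map_0)

lemma map_poly_add_eval:
  "poly (map_poly \<phi> (p + q)) h = poly (map_poly \<phi> p) h + poly (map_poly \<phi> q) h"
  by (induction p q rule: poly_induct2) (simp_all add: map_poly_pCons_eval map_add algebra_simps)

lemma map_poly_smult_eval: "poly (map_poly \<phi> (smult c p)) h = \<phi> c * poly (map_poly \<phi> p) h"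
  by (induction p) (simp_all add: map_poly_pCons_eval map_mult algebra_simps)

lemma map_poly_mult_eval:
  "poly (map_poly \<phi> (p * q)) h = poly (map_poly \<phi> p) h * poly (map_poly \<phi> q) h"
  by (induction p)
     (simp_all add: map_poly_pCons_eval map_poly_add_eval map_poly_smult_eval map_0 algebra_simps)

lemma map_poly_sum_eval:
  "poly (map_poly \<phi> (\<Sum>i\<in>A. p i)) h = (\<Sum>i\<in>A. poly (map_poly \<phi> (p i)) h)"
  by (induction A rule: infinite_finite_induct) (simp_all add: map_poly_add_eval)

lemma map_poly_prod_eval:
  "poly (map_poly \<phi> (\<Prod>i\<in>A. p i)) h = (\<Prod>i\<in>A. poly (map_poly \<phi> (p i)) h)"
  by (induction A rule: infinite_finite_induct)
     (simp_all add: map_poly_mult_eval map_poly_pCons_eval map_1 map_poly_1)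

end

text \<open>At the node \<open>x c\<close> all summands vanish except the one for \<open>c\<close>,
  as in Lagrange interpolation. This guarantees that clearing denominators leaves a nontrivial
  equation.\<close>

lemma lagrange_combination_nonzero:
  fixes x :: "'i \<Rightarrow> 'a::idom"
  assumes "finite B" "inj_on x B" "c \<in> B" "a c \<noteq> 0"
  shows "(\<Sum>c\<in>B. smult (a c) (\<Prod>k\<in>B - {c}. [:- x k, 1:])) \<noteq> 0" (is "?g \<noteq> 0")
proof -
  have "poly ?g (x c) = (\<Sum>d\<in>B. a d * (\<Prod>k\<in>B - {d}. x c - x k))"
    by (simp add: poly_sum poly_prod)
  also have "\<dots> = (\<Sum>d\<in>{c}. a d * (\<Prod>k\<in>B - {d}. x c - x k))"
    using assms by (intro sum.mono_neutral_right) auto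
  also have "\<dots> \<noteq> 0"
    using assms by (auto simp: prod_zero_iff inj_on_def)
  finally show ?thesis by (metis poly_0)
qed

text \<open>\<open>g\<close> splits into linear factors over the complex numbers, and a prime ideal
  that contains a product contains a factor.\<close>

lemma prime_ideal_contains_linear_factor:
  fixes J :: "complex_mpoly set"
  assumes J: "prime_ideal J" and "g \<noteq> 0" "poly (map_poly mconst g) h \<in> J"
  obtains r where "h - mconst r \<in> J"
  using assms(2,3)
proof (induction "degree g" arbitrary: g thesis rule: less_induct)
  case less
  show ?case
  proof (cases "degree g = 0")
    case True
    then obtain c where g: "g = [:c:]" by (metis degree_eq_zeroE)
    with less.prems have "mconst (1 / c) * mconst c \<in> J"
      using J by (intro ideal_mult) (auto simp: prime_ideal_def mconst.map_poly_pCons_eval)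
    moreover have "mconst (1 / c) * mconst c = 1"
      using g less.prems(2) by (simp flip: mconst.map_mult add: mconst.map_1)
    ultimately show ?thesis using J by (simp add: prime_ideal_def)
  next
    case False
    then have "\<exists>i\<in>{1..degree g}. coeff g i \<noteq> 0"
      using less.prems(2) by (intro bexI[of _ "degree g"]) auto
    then obtain z where "poly g z = 0"
      using fundamental_theorem_of_algebra[of "coeff g" "degree g"] unfolding poly_altdef by metis
    then obtain q where q: "g = [:- z, 1:] * q" by (auto simp: poly_eq_0_iff_dvd)
    have "q \<noteq> 0" using q less.prems(2) by auto
    then have deg: "degree q < degree g" unfolding q by (subst degree_mult_eq) auto
    have "(h - mconst z) * poly (map_poly mconst q) h \<in> J"
      using less.prems(3) mconst_diff[of 0 z]
      by (simp only: q mconst.map_poly_mult_eval mconst.map_poly_pCons_eval)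
         (simp add: mconst.map_0 mconst.map_1)
    then consider "h - mconst z \<in> J" | "poly (map_poly mconst q) h \<in> J"
      using J by (auto simp: prime_ideal_def)
    then show ?thesis using less.hyps[OF deg _ \<open>q \<noteq> 0\<close>] less.prems(1) by cases blast+
  qed
qed

text \<open>Take \<open>J\<close> above \<open>Q\<close>, maximal among ideals without powers of
  \<open>u\<close>. If a variable were congruent to no constant, the inverses of all
  \<open>mvar i - c\<close> up to powers of \<open>u\<close> would be dependent, giving a complex
  polynomial in \<open>mvar i\<close> inside \<open>J\<close>, hence a linear one. So every variable
  is a constant modulo \<open>J\<close>, and these constants form the point. Countably many
  monomials suffice, so infinitely many variables do no harm.\<close>

lemma nullstellensatz:
  fixes Q :: "complex_mpoly set"
  assumes Q: "prime_ideal Q" and u: "u \<notin> Q"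
  obtains a where "\<forall>F\<in>Q. poly_eval id a F = 0" "poly_eval id a u \<noteq> 0"
proof -
  define S where "S = range (\<lambda>k::nat. u ^ k)"
  have S1: "1 \<in> S" unfolding S_def by (rule image_eqI[of _ _ 0]) auto
  have S2: "s * t \<in> S" if "s \<in> S" "t \<in> S" for s t
    using that by (auto simp: S_def simp flip: power_add)
  have QS: "Q \<inter> S = {}" using prime_ideal_power[OF Q u] by (auto simp: S_def)
  have iQ: "ideal Q" using Q by (simp add: prime_ideal_def)
  obtain J where J: "prime_ideal J" "Q \<subseteq> J" "J \<inter> S = {}"
    and ex: "\<forall>h. h \<notin> J \<longrightarrow> (\<exists>b. \<exists>s\<in>S. b * h - s \<in> J)"
    by (rule exists_prime_ideal_avoiding[OF iQ S1 S2 QS])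
  have iJ: "ideal J" using J(1) by (simp add: prime_ideal_def)
  have "\<exists>c. mvar i - mconst c \<in> J" for i
  proof (rule ccontr)
    define h where "h = mvar i"
    assume none: "\<nexists>c. mvar i - mconst c \<in> J"
    have "\<exists>b k. b * (h - mconst c) - u ^ k \<in> J" for c
      using ex[rule_format, of "h - mconst c"] none by (auto simp: S_def h_def)
    then obtain b k where bk: "\<And>c. b c * (h - mconst c) - u ^ k c \<in> J" by metis
    \<comment> \<open>The exponent of \<open>u\<close> varies with \<open>c\<close> but takes
      countably many values, so it is constant on an uncountable set.\<close>
    obtain m :: nat where m: "uncountable {c \<in> UNIV. k c = m}"
      using uncountable_fibre[OF uncountable_UNIV_complex] by blast
    have "b c * (h - mconst c) - u ^ m \<in> J" if "c \<in> {c \<in> UNIV. k c = m}" for c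
      using bk[of c] that by simp
    then obtain B l where B: "finite B" "\<exists>c\<in>B. l c \<noteq> 0"
      "(\<Sum>c\<in>B. mconst (l c) * u ^ m * (\<Prod>k\<in>B - {c}. h - mconst k)) \<in> J"
      by (rule uncountable_quotients_relation[OF iJ m, of b h "\<lambda>_. u ^ m"])
    have "(\<Sum>c\<in>B. mconst (l c) * u ^ m * (\<Prod>k\<in>B - {c}. h - mconst k)) =
        u ^ m * (\<Sum>c\<in>B. mconst (l c) * (\<Prod>k\<in>B - {c}. h - mconst k))"
      unfolding sum_distrib_left by (simp only: mult_ac)
    \<comment> \<open>The power \<open>u ^ m\<close> lies outside the prime \<open>J\<close> and can
      be cancelled.\<close>
    with B(3) J have rel: "(\<Sum>c\<in>B. mconst (l c) * (\<Prod>k\<in>B - {c}. h - mconst k)) \<in> J"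
      by (auto simp: prime_ideal_def S_def)
    define g where "g = (\<Sum>c\<in>B. smult (l c) (\<Prod>k\<in>B - {c}. [:- k, 1:]))"
    have "g \<noteq> 0" unfolding g_def
      using lagrange_combination_nonzero[of B "\<lambda>k. k" _ l] B(1,2) by auto
    moreover have "mconst (- c) + h = h - mconst c" for c
      using mconst_diff[of 0 c] by (simp add: mconst.map_0)
    then have "poly (map_poly mconst g) h \<in> J"
      using rel unfolding g_def
      by (simp add: mconst.map_poly_sum_eval mconst.map_poly_smult_eval mconst.map_poly_prod_eval
        mconst.map_poly_pCons_eval mconst.map_1)
    ultimately obtain r where "h - mconst r \<in> J"
      using prime_ideal_contains_linear_factor[OF J(1)] by blast
    with none show False by (auto simp: h_def)
  qed
  then obtain a where a: "\<And>i. mvar i - mconst (a i) \<in> J" by metis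
  \<comment> \<open>Reduction modulo \<open>J\<close> is evaluation at \<open>a\<close>. As
    \<open>J\<close> contains no nonzero constant, members of \<open>Q\<close> vanish at
    \<open>a\<close>; as it omits \<open>u\<close>, the value of \<open>u\<close> is
    nonzero.\<close>
  have mem: "F - mconst (poly_eval id a F) \<in> J" for F
  proof (rule mpoly_induct[where P = "\<lambda>F. F - mconst (poly_eval id a F) \<in> J"])
    show "mconst c - mconst (poly_eval id a (mconst c)) \<in> J" for c
      unfolding eval_id.poly_eval_mconst by (simp add: ideal_0[OF iJ])
    show "mvar i - mconst (poly_eval id a (mvar i)) \<in> J" for i
      unfolding eval_id.poly_eval_mvar by (rule a)
  next
    fix F G
    assume mem: "F - mconst (poly_eval id a F) \<in> J" "G - mconst (poly_eval id a G) \<in> J"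
    show "F + G - mconst (poly_eval id a (F + G)) \<in> J"
      using ideal_add[OF iJ mem]
      unfolding eval_id.poly_eval_add by (simp add: mconst.map_add algebra_simps)
    have "F * G - mconst (poly_eval id a (F * G)) =
      G * (F - mconst (poly_eval id a F)) + mconst (poly_eval id a F) * (G - mconst (poly_eval id a G))"
      unfolding eval_id.poly_eval_mult by (simp add: mconst.map_mult algebra_simps)
    also have "\<dots> \<in> J" by (intro ideal_add[OF iJ] ideal_mult[OF iJ] mem)
    finally show "F * G - mconst (poly_eval id a (F * G)) \<in> J" .
  qed
  show thesis
  proof (rule that[OF ballI])
    fix F assume "F \<in> Q"
    with J(2) have "F - (F - mconst (poly_eval id a F)) \<in> J"
      by (intro ideal_diff[OF iJ] mem) auto
    then have *: "mconst (poly_eval id a F) \<in> J" by simp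
    show "poly_eval id a F = 0"
    proof (rule ccontr)
      assume "poly_eval id a F \<noteq> 0"
      then have "mconst (1 / poly_eval id a F) * mconst (poly_eval id a F) = 1"
        by (simp flip: mconst.map_mult add: mconst.map_1)
      with ideal_mult[OF iJ *] J(1) show False unfolding prime_ideal_def by metis
    qed
  next
    show "poly_eval id a u \<noteq> 0"
    proof
      assume "poly_eval id a u = 0"
      with mem[of u] have "u ^ 1 \<in> J" by (simp add: mconst.map_0)
      moreover have "u ^ 1 \<in> S" unfolding S_def by (rule rangeI)
      ultimately show False using J(3) by blast
    qed
  qed
qed

section \<open>Prime ideals and irreducible algebraic sets\<close>

text \<open>\<open>P\<close> lives in the polynomial ring in all variables, whereas points have
  \<open>n\<close> coordinates; hence only the contraction of \<open>P\<close> to the first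
  \<open>n\<close> variables is imposed.\<close>

definition prime_zeros :: "nat \<Rightarrow> complex_mpoly set \<Rightarrow> (nat \<Rightarrow> complex) set" where
  "prime_zeros n P = zero_set n {F \<in> P. poly_vars F \<subseteq> {..<n}}"

text \<open>The product of the finite set \<open>G\<close> stays outside the prime \<open>P\<close>,
  so one application of the Nullstellensatz handles all its members.\<close>

lemma prime_zeros_nonvanishing:
  assumes P: "prime_ideal P" and G: "finite G" "\<And>g. g \<in> G \<Longrightarrow> g \<notin> P"
    "\<And>g. g \<in> G \<Longrightarrow> poly_vars g \<subseteq> {..<n}"
  shows "\<exists>a\<in>prime_zeros n P. \<forall>g\<in>G. poly_eval id a g \<noteq> 0"
proof -
  have "prod (\<lambda>g. g) G \<notin> P" by (rule prime_ideal_prod[OF P G(1,2)])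
  then obtain a where a: "\<forall>F\<in>P. poly_eval id a F = 0" "poly_eval id a (prod (\<lambda>g. g) G) \<noteq> 0"
    by (rule nullstellensatz[OF P])
  define b where "b = restrict a {..<n}"
  have b: "poly_eval id b F = poly_eval id a F" if "poly_vars F \<subseteq> {..<n}" for F
    by (rule poly_eval_cong_vars[OF that]) (simp add: b_def)
  have "b \<in> prime_zeros n P"
    unfolding prime_zeros_def zero_set_def using a(1) b restrict_PiE_iff by (simp add: b_def)
  moreover have "\<forall>g\<in>G. poly_eval id a g \<noteq> 0"
    using a(2) G(1) unfolding eval_id.poly_eval_prod by (metis prod_zero)
  ultimately show ?thesis using b G(3) by (intro bexI[of _ b]) simp_all
qed

lemma algebraic_set_prime_zeros: "algebraic_set n (prime_zeros n P)"
  unfolding algebraic_set_def prime_zeros_def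
  by (rule exI[of _ "{F \<in> P. poly_vars F \<subseteq> {..<n}}"]) simp

text \<open>A point outside \<open>C\<close> violates some defining equation of \<open>C\<close>.
  That equation is not in \<open>P\<close> if the point is a zero of \<open>P\<close>.\<close>

lemma algebraic_set_separating:
  assumes "algebraic_set n C" "\<not> prime_zeros n P \<subseteq> C"
  shows "\<exists>g. g \<notin> P \<and> poly_vars g \<subseteq> {..<n} \<and> (\<forall>a\<in>C. poly_eval id a g = 0)"
proof -
  obtain S where S: "\<forall>F\<in>S. poly_vars F \<subseteq> {..<n}" "C = zero_set n S"
    using assms(1) unfolding algebraic_set_def by (elim exE conjE) (rule that)
  obtain a where a: "a \<in> prime_zeros n P" "a \<notin> C" using assms(2) by blast
  have "a \<in> affine_space n" and aP: "\<And>F. F \<in> P \<Longrightarrow> poly_vars F \<subseteq> {..<n} \<Longrightarrow> poly_eval id a F = 0"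
    using a(1) by (simp_all add: prime_zeros_def zero_set_def)
  with a(2) obtain g where g: "g \<in> S" "poly_eval id a g \<noteq> 0"
    unfolding S(2) zero_set_def by auto
  with aP S(1) have "g \<notin> P" by auto
  moreover have "\<forall>a\<in>C. poly_eval id a g = 0" using g(1) unfolding S(2) zero_set_def by simp
  ultimately show ?thesis using g(1) S(1) by auto
qed

text \<open>Otherwise each \<open>D\<close> has an equation outside \<open>P\<close>, and some zero
  of \<open>P\<close> violates all these equations at once, hence lies in no \<open>D\<close>.
  Irreducibility is the case of two sets.\<close>

lemma prime_zeros_subset_Union:
  assumes P: "prime_ideal P" and "finite \<D>" "\<And>D. D \<in> \<D> \<Longrightarrow> algebraic_set n D"
    and sub: "prime_zeros n P \<subseteq> \<Union>\<D>"
  shows "\<exists>D\<in>\<D>. prime_zeros n P \<subseteq> D"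
proof (rule ccontr)
  assume "\<not> ?thesis"
  then have "\<forall>D\<in>\<D>. \<exists>g. g \<notin> P \<and> poly_vars g \<subseteq> {..<n} \<and> (\<forall>a\<in>D. poly_eval id a g = 0)"
    using algebraic_set_separating assms(3) by blast
  then obtain g where g: "\<And>D. D \<in> \<D> \<Longrightarrow> g D \<notin> P"
    "\<And>D. D \<in> \<D> \<Longrightarrow> poly_vars (g D) \<subseteq> {..<n}"
    "\<And>D a. D \<in> \<D> \<Longrightarrow> a \<in> D \<Longrightarrow> poly_eval id a (g D) = 0" by metis
  obtain a where a: "a \<in> prime_zeros n P" "\<forall>h\<in>g ` \<D>. poly_eval id a h \<noteq> 0"
    using prime_zeros_nonvanishing[OF P, of "g ` \<D>" n] assms(2) g(1,2) by blast
  obtain D where "D \<in> \<D>" "a \<in> D" using a(1) sub by blast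
  with g(3) a(2) show False by blast
qed

lemma irreducible_prime_zeros:
  assumes P: "prime_ideal P"
  shows "irreducible_algebraic_set n (prime_zeros n P)"
  unfolding irreducible_algebraic_set_def
proof (intro conjI allI impI algebraic_set_prime_zeros)
  show "prime_zeros n P \<noteq> {}"
    using prime_zeros_nonvanishing[OF P, of "{}" n] by blast
next
  fix A B assume "algebraic_set n A \<and> algebraic_set n B \<and> prime_zeros n P = A \<union> B"
  then have "algebraic_set n A" "algebraic_set n B" and eq: "prime_zeros n P = A \<union> B" by auto
  then have "\<exists>D\<in>{A, B}. prime_zeros n P \<subseteq> D"
    by (intro prime_zeros_subset_Union[OF P]) auto
  then show "prime_zeros n P = A \<or> prime_zeros n P = B" using eq by blast
qed

section \<open>Points, and the chains that dimension one excludes\<close>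

lemma algebraic_set_singleton:
  assumes "p \<in> affine_space n"
  shows "algebraic_set n {p}"
proof -
  define S where "S = (\<lambda>i. mvar i - mconst (p i)) ` {..<n}"
  have ev: "poly_eval id a (mvar i - mconst (p i)) = a i - p i" for a i
    by (simp only: eval_id.poly_eval_diff eval_id.poly_eval_mvar eval_id.poly_eval_mconst id_apply)
  have "zero_set n S = {p}"
  proof (intro equalityI subsetI)
    fix a assume a: "a \<in> zero_set n S"
    then have "a i = p i" if "i < n" for i using that ev[of a i] by (auto simp: zero_set_def S_def)
    then have "a = p" using a assms by (intro PiE_ext[of a "{..<n}" _ p]) (auto simp: zero_set_def)
    then show "a \<in> {p}" by simp
  qed (use assms ev in \<open>auto simp: zero_set_def S_def\<close>)
  moreover have "\<forall>F\<in>S. poly_vars F \<subseteq> {..<n}"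
    using poly_vars_mvar_diff_mconst unfolding S_def by fastforce
  ultimately show ?thesis unfolding algebraic_set_def by (intro exI[of _ S]) simp
qed

lemma irreducible_singleton:
  assumes "p \<in> affine_space n"
  shows "irreducible_algebraic_set n {p}"
proof -
  have "{p} = A \<or> {p} = B" if "{p} = A \<union> B" for A B
    using that by (metis singleton_Un_iff)
  then show ?thesis
    unfolding irreducible_algebraic_set_def using algebraic_set_singleton[OF assms] by simp
qed

text \<open>
  If every \<open>mvar 1 - c\<close> were invertible modulo \<open>P\<close> up to \<open>S\<close>, the inverses would be uncountably
  many elements of a space of countable dimension, which gives the second alternative. Otherwise
  some prime \<open>J\<close> between \<open>P\<close> and a point provides a chain of length two.
\<close>

lemma dimension_one_relation:
  assumes dim: "dimension_one n V" and n: "n \<ge> 2"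
    and P: "prime_ideal P" and PV: "prime_zeros n P \<subseteq> V"
    and S: "1 \<in> S" "\<And>s t. s \<in> S \<Longrightarrow> t \<in> S \<Longrightarrow> s * t \<in> S" "P \<inter> S = {}"
      "\<And>c. mvar 0 - mconst c \<in> S"
  obtains (const) c where "mvar 1 - mconst c \<in> P"
  | (relation) B l s where "finite B" "\<exists>c\<in>B. l c \<noteq> 0" "\<forall>c\<in>B. s c \<in> S"
      "(\<Sum>c\<in>B. mconst (l c) * s c * (\<Prod>k\<in>B - {c}. mvar 1 - mconst k)) \<in> P"
proof (cases "\<exists>c. mvar 1 - mconst c \<in> P")
  case True
  then show ?thesis using const by blast
next
  case const: False
  have iP: "ideal P" using P by (simp add: prime_ideal_def)
  define h where "h = mvar 1"
  show ?thesis
  proof (cases "\<forall>c. \<exists>b. \<exists>s\<in>S. b * (h - mconst c) - s \<in> P")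
    case True
    then obtain b s where bs: "\<And>c. b c * (h - mconst c) - s c \<in> P" "\<And>c. s c \<in> S" by metis
    obtain B l where "finite B" "\<exists>c\<in>B. l c \<noteq> 0"
      "(\<Sum>c\<in>B. mconst (l c) * s c * (\<Prod>k\<in>B - {c}. h - mconst k)) \<in> P"
      by (rule uncountable_quotients_relation[OF iP uncountable_UNIV_complex, of b h s])
         (use bs in auto)
    then show ?thesis using relation[of B l s] bs(2) by (simp add: h_def)
  next
    case False
    then obtain c where c: "\<And>b s. s \<in> S \<Longrightarrow> b * (h - mconst c) - s \<notin> P" by blast
    \<comment> \<open>Adjoining \<open>h - mconst c\<close> to \<open>P\<close> does not reach
      \<open>S\<close>, precisely because this element is not invertible up to
      \<open>S\<close>.\<close>
    define I where "I = {q + b * (h - mconst c) | q b. q \<in> P}"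
    have iI: "ideal I" unfolding I_def by (rule ideal_adjoin[OF iP])
    have inI: "q + b * (h - mconst c) \<in> I" if "q \<in> P" for q b unfolding I_def using that by blast
    have IS: "I \<inter> S = {}"
    proof (rule ccontr)
      assume "I \<inter> S \<noteq> {}"
      then obtain q b where qb: "q \<in> P" "q + b * (h - mconst c) \<in> S" unfolding I_def by blast
      have "b * (h - mconst c) - (q + b * (h - mconst c)) \<in> P"
        using ideal_uminus[OF iP qb(1)] by simp
      with c[OF qb(2)] show False by blast
    qed
    obtain J where J: "prime_ideal J" "I \<subseteq> J" "J \<inter> S = {}"
      by (rule exists_prime_ideal_avoiding[OF iI S(1,2) IS])
    have PJ: "P \<subseteq> J" using inI[of _ 0] J(2) by auto
    have hJ: "h - mconst c \<in> J" using inI[OF ideal_0[OF iP], of 1] J(2) by auto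
    obtain a where a: "a \<in> prime_zeros n J" using irreducible_prime_zeros[OF J(1), of n]
      by (auto simp: irreducible_algebraic_set_def)
    have a_aff: "a \<in> affine_space n" using a by (auto simp: prime_zeros_def zero_set_def)
    have ev: "poly_eval id x (mvar i - mconst y) = x i - y" for x i y
      by (simp only: eval_id.poly_eval_diff eval_id.poly_eval_mvar eval_id.poly_eval_mconst id_apply)
    have vars: "poly_vars (mvar i - mconst y) \<subseteq> {..<n}" if "i < n" for i y
      using poly_vars_mvar_diff_mconst[of i y] that by auto
    \<comment> \<open>As \<open>S\<close> contains every \<open>mvar 0 - mconst c\<close>,
      coordinate 0 is not constant on the zeros of \<open>J\<close>, so these are more than one
      point.\<close>
    have "mvar 0 - mconst (a 0) \<notin> J" using S(4) J(3) by blast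
    then obtain a' where a': "a' \<in> prime_zeros n J" "a' 0 \<noteq> a 0"
      using prime_zeros_nonvanishing[OF J(1), of "{mvar 0 - mconst (a 0)}" n] vars[of 0] n
      by (auto simp: ev)
    have "h - mconst c \<notin> P" using const by (auto simp: h_def)
    then obtain a'' where a'': "a'' \<in> prime_zeros n P" "a'' 1 \<noteq> c"
      using prime_zeros_nonvanishing[OF P, of "{h - mconst c}" n] vars[of 1] n
      by (auto simp: ev h_def)
    have sub: "prime_zeros n J \<subseteq> prime_zeros n P"
      using PJ unfolding prime_zeros_def zero_set_def by blast
    have "x 1 = c" if "x \<in> prime_zeros n J" for x
      using that hJ vars[of 1 c] n ev[of x 1 c] by (auto simp: prime_zeros_def zero_set_def h_def)
    then have "a'' \<notin> prime_zeros n J" using a''(2) by blast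
    with sub a''(1) have lt2: "prime_zeros n J \<subset> prime_zeros n P" by blast
    have "a' \<noteq> a" using a'(2) by auto
    then have lt1: "{a} \<subset> prime_zeros n J" using a a'(1) by blast
    from dim[unfolded dimension_one_def] obtain \<C> Q where "finite \<C> \<and> \<C> \<noteq> {} \<and>
        (\<forall>C\<in>\<C>. algebraic_curve n C) \<and> finite Q \<and> Q \<subseteq> affine_space n \<and> V = \<Union>\<C> \<union> Q"
      by (elim exE) (rule that)
    then have \<C>: "finite \<C>" "\<forall>C\<in>\<C>. algebraic_curve n C"
      and Q: "finite Q" "Q \<subseteq> affine_space n" and V: "V = \<Union>\<C> \<union> Q" by simp_all
    \<comment> \<open>The isolated points are added as singletons; they cannot contain the two
      distinct points found above, so a curve remains.\<close>
    have "\<exists>D\<in>\<C> \<union> (\<lambda>p. {p}) ` Q. prime_zeros n P \<subseteq> D"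
    proof (rule prime_zeros_subset_Union[OF P])
      show "prime_zeros n P \<subseteq> \<Union>(\<C> \<union> (\<lambda>p. {p}) ` Q)" using PV V by auto
      show "algebraic_set n D" if "D \<in> \<C> \<union> (\<lambda>p. {p}) ` Q" for D
        using that \<C>(2) Q(2) algebraic_set_singleton
        by (auto simp: algebraic_curve_def irreducible_algebraic_set_def)
    qed (use \<C>(1) Q(1) in auto)
    then obtain C where C: "C \<in> \<C>" "prime_zeros n P \<subseteq> C" using lt1 lt2 by blast
    have dimC: "krull_dim n C = 1" using \<C>(2) C(1) by (auto simp: algebraic_curve_def)
    \<comment> \<open>A point, the zeros of \<open>J\<close> and the zeros of \<open>P\<close> form
      a chain of length two inside the curve \<open>C\<close>.\<close>
    define Z where "Z = (\<lambda>i::nat. if i = 0 then {a} else if i = 1 then prime_zeros n J else prime_zeros n P)"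
    have "\<forall>i\<le>2. irreducible_algebraic_set n (Z i) \<and> Z i \<subseteq> C"
      using irreducible_singleton[OF a_aff] irreducible_prime_zeros[OF J(1)]
        irreducible_prime_zeros[OF P] lt1 lt2 C(2) unfolding Z_def by (auto split: if_splits)
    moreover have "Z i \<subset> Z (Suc i)" if "i < 2" for i
      using less_2_cases[OF that] lt1 lt2 unfolding Z_def by (elim disjE) simp_all
    ultimately have "enat 2 \<in> {enat k | k. \<exists>Z. (\<forall>i\<le>k. irreducible_algebraic_set n (Z i) \<and> Z i \<subseteq> C) \<and>
        (\<forall>i<k. Z i \<subset> Z (Suc i))}"
      by (intro CollectI exI[of _ 2] exI[of _ Z] conjI allI impI refl) simp_all
    then have "enat 2 \<le> krull_dim n C" unfolding krull_dim_def by (rule Sup_upper)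
    then show ?thesis using dimC by (simp add: one_enat_def)
  qed
qed

section \<open>Convergent power series\<close>

text \<open>The weighted l1 norm of the Taylor polynomial of degree \<open>n\<close>. Truncation
  keeps it finite for divergent series, so that convergence can be proved by bounds independent of
  \<open>n\<close>.\<close>

definition truncated_norm :: "real \<Rightarrow> nat \<Rightarrow> complex fps \<Rightarrow> real" where
  "truncated_norm r n u = (\<Sum>i\<le>n. norm (fps_nth u i) * r ^ i)"

lemma truncated_norm_nonneg: "r \<ge> 0 \<Longrightarrow> truncated_norm r n u \<ge> 0"
  by (auto simp: truncated_norm_def intro!: sum_nonneg)

lemma truncated_norm_0: "truncated_norm r n 0 = 0"
  by (simp add: truncated_norm_def)

lemma truncated_norm_1: "truncated_norm r n 1 = 1"
proof -
  have "truncated_norm r n 1 = (\<Sum>i\<in>{0}. norm (fps_nth (1 :: complex fps) i) * r ^ i)"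
    unfolding truncated_norm_def by (rule sum.mono_neutral_right) auto
  then show ?thesis by simp
qed

lemma truncated_norm_add:
  assumes "r \<ge> 0"
  shows "truncated_norm r n (u + v) \<le> truncated_norm r n u + truncated_norm r n v"
proof -
  have "norm (fps_nth (u + v) i) * r ^ i \<le> norm (fps_nth u i) * r ^ i + norm (fps_nth v i) * r ^ i" for i
    using mult_right_mono[OF norm_triangle_ineq[of "fps_nth u i" "fps_nth v i"], of "r ^ i"] assms
    by (simp add: distrib_right)
  then show ?thesis
    unfolding truncated_norm_def sum.distrib[symmetric] by (rule sum_mono)
qed

lemma truncated_norm_sum:
  assumes "r \<ge> 0"
  shows "truncated_norm r n (\<Sum>i\<in>A. u i) \<le> (\<Sum>i\<in>A. truncated_norm r n (u i))"
  by (induction A rule: infinite_finite_induct)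
     (auto simp: truncated_norm_0 intro: order_trans[OF truncated_norm_add[OF assms]])

lemma truncated_norm_mult:
  assumes "r \<ge> 0"
  shows "truncated_norm r n (u * v) \<le> truncated_norm r n u * truncated_norm r n v"
proof -
  define a b where "a = (\<lambda>i. norm (fps_nth u i) * r ^ i)" and "b = (\<lambda>i. norm (fps_nth v i) * r ^ i)"
  have nonneg: "a i * b j \<ge> 0" for i j using assms by (simp add: a_def b_def)
  have "norm (fps_nth (u * v) i) * r ^ i \<le> (\<Sum>j\<le>i. a j * b (i - j))" for i
  proof -
    have "norm (fps_nth (u * v) i) \<le> (\<Sum>j\<le>i. norm (fps_nth u j) * norm (fps_nth v (i - j)))"
      unfolding fps_mult_nth atLeast0AtMost
      by (rule order_trans[OF norm_sum]) (simp add: norm_mult)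
    then have "norm (fps_nth (u * v) i) * r ^ i \<le>
        (\<Sum>j\<le>i. norm (fps_nth u j) * norm (fps_nth v (i - j))) * r ^ i"
      using assms by (intro mult_right_mono) auto
    also have "\<dots> = (\<Sum>j\<le>i. a j * b (i - j))"
      unfolding sum_distrib_right a_def b_def
      by (intro sum.cong) (auto simp flip: power_add simp: algebra_simps)
    finally show ?thesis .
  qed
  then have "truncated_norm r n (u * v) \<le> (\<Sum>i\<le>n. \<Sum>j\<le>i. a j * b (i - j))"
    unfolding truncated_norm_def by (rule sum_mono)
  also have "\<dots> = (\<Sum>(i, j)\<in>{(i, j). i + j \<le> n}. a i * b j)"
    by (simp add: sum.triangle_reindex_eq)
  \<comment> \<open>The triangle of index pairs is enlarged to the full square; the added terms are
    nonnegative.\<close>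
  also have "\<dots> \<le> (\<Sum>(i, j)\<in>{..n} \<times> {..n}. a i * b j)"
    by (rule sum_mono2) (auto simp: nonneg)
  also have "\<dots> = truncated_norm r n u * truncated_norm r n v"
    by (simp add: truncated_norm_def a_def b_def sum_product sum.cartesian_product)
  finally show ?thesis .
qed

lemma truncated_norm_power:
  assumes "r \<ge> 0"
  shows "truncated_norm r n (u ^ k) \<le> truncated_norm r n u ^ k"
proof (induction k)
  case 0
  then show ?case by (simp add: truncated_norm_1)
next
  case (Suc k)
  have "truncated_norm r n (u * u ^ k) \<le> truncated_norm r n u * truncated_norm r n (u ^ k)"
    by (rule truncated_norm_mult[OF assms])
  also have "\<dots> \<le> truncated_norm r n u * truncated_norm r n u ^ k"
    by (intro mult_left_mono Suc truncated_norm_nonneg assms)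
  finally show ?case by simp
qed

lemma truncated_norm_X_mult:
  "truncated_norm r (Suc n) (fps_X * u) = r * truncated_norm r n u"
  unfolding truncated_norm_def sum.atMost_Suc_shift
  by (simp add: sum_distrib_left mult_ac)

lemma fps_conv_radius_pos_if_bounded:
  fixes u :: "complex fps"
  assumes r: "r > 0" and bd: "\<And>n. norm (fps_nth u n) * r ^ n \<le> C"
  shows "fps_conv_radius u > 0"
proof -
  define z where "z = complex_of_real (r / 2)"
  have z: "norm z = r / 2" using r by (simp add: z_def)
  have "summable (\<lambda>n. fps_nth u n * z ^ n)"
  proof (rule summable_comparison_test)
    show "summable (\<lambda>n. C * (1 / 2) ^ n :: real)" by (intro summable_mult summable_geometric) auto
    have "norm (fps_nth u n * z ^ n) \<le> C * (1 / 2) ^ n" for n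
      using mult_right_mono[OF bd[of n], of "(1 / 2) ^ n"]
      by (simp add: norm_mult norm_power z power_divide)
    then show "\<exists>N. \<forall>n\<ge>N. norm (fps_nth u n * z ^ n) \<le> C * (1 / 2) ^ n" by blast
  qed
  then have "ereal (norm z) \<le> fps_conv_radius u"
    unfolding fps_conv_radius_def by (rule conv_radius_geI)
  moreover have "(0::ereal) < ereal (norm z)" using r by (simp add: z)
  ultimately show ?thesis by (rule less_le_trans[rotated])
qed

text \<open>The bound covers all smaller radii, so that finitely many series can later be treated
  with one common radius.\<close>

lemma truncated_norm_bounded:
  assumes "fps_conv_radius u > 0"
  shows "\<exists>r C. r > 0 \<and> (\<forall>n s. 0 \<le> s \<longrightarrow> s \<le> r \<longrightarrow> truncated_norm s n u \<le> C)"
proof -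
  obtain r where r: "0 < ereal r" "ereal r < fps_conv_radius u"
    using ereal_dense2[OF assms] by blast
  then have "ereal (norm (complex_of_real r)) < conv_radius (fps_nth u)"
    by (simp add: fps_conv_radius_def)
  then have "summable (\<lambda>n. norm (fps_nth u n * complex_of_real r ^ n))"
    by (rule abs_summable_in_conv_radius)
  then have sm: "summable (\<lambda>n. norm (fps_nth u n) * r ^ n)"
    using r(1) by (simp add: norm_mult norm_power)
  have "truncated_norm s n u \<le> suminf (\<lambda>n. norm (fps_nth u n) * r ^ n)" if "0 \<le> s" "s \<le> r" for s n
  proof -
    have "truncated_norm s n u \<le> truncated_norm r n u"
      unfolding truncated_norm_def using that by (intro sum_mono mult_left_mono power_mono) auto
    also have "\<dots> \<le> suminf (\<lambda>n. norm (fps_nth u n) * r ^ n)"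
      unfolding truncated_norm_def using r(1) by (intro sum_le_suminf[OF sm]) auto
    finally show ?thesis .
  qed
  then show ?thesis using r(1) by (intro exI[of _ r] exI[of _ "suminf (\<lambda>n. norm (fps_nth u n) * r ^ n)"]) auto
qed

text \<open>
  Since \<open>u\<^sub>0 = 0\<close> and multiplication by \<open>X\<close> shifts the truncation, a bound on the
  \<open>n\<close>-th truncated norm of \<open>u\<close> gives one on the next, uniformly in \<open>n\<close> once \<open>r\<close> is small.
\<close>

lemma fps_conv_radius_contraction_fixpoint:
  fixes u :: "complex fps" and Q :: "complex fps poly"
  assumes u: "u = fps_X * poly Q u" and Q: "\<And>i. fps_conv_radius (coeff Q i) > 0"
  shows "fps_conv_radius u > 0"
proof -
  have "\<forall>i. \<exists>r C. r > 0 \<and> (\<forall>n s. 0 \<le> s \<longrightarrow> s \<le> r \<longrightarrow> truncated_norm s n (coeff Q i) \<le> C)"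
    using truncated_norm_bounded[OF Q] by simp
  then obtain R C where R: "\<And>i. R i > 0"
    and C: "\<And>i n s. 0 \<le> s \<Longrightarrow> s \<le> R i \<Longrightarrow> truncated_norm s n (coeff Q i) \<le> C i" by metis
  define d where "d = degree Q"
  define K where "K = (\<Sum>i\<le>d. \<bar>C i\<bar>) + 1"
  have K: "K > 0" unfolding K_def by (simp add: sum_nonneg add_nonneg_pos)
  \<comment> \<open>The radius suits every coefficient of \<open>Q\<close> and satisfies
    \<open>r * K \<le> 1\<close>, which keeps the bound 1 stable under the recursion.\<close>
  define r where "r = min (Min (R ` {..d})) (1 / K)"
  have r: "r > 0" using R K by (auto simp: r_def)
  have rR: "r \<le> R i" if "i \<le> d" for i
    using that unfolding r_def by (intro min.coboundedI1 Min_le) auto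
  have rK: "r * K \<le> 1" using K by (auto simp: r_def min_def field_simps)
  have bound: "truncated_norm r n u \<le> 1" for n
  proof (induction n)
    case 0
    have "fps_nth u 0 = 0" by (subst u) simp
    then show ?case by (simp add: truncated_norm_def)
  next
    case (Suc n)
    have "truncated_norm r n (poly Q u) \<le> (\<Sum>i\<le>d. truncated_norm r n (coeff Q i * u ^ i))"
      unfolding poly_altdef d_def by (rule truncated_norm_sum) (use r in simp)
    also have "\<dots> \<le> (\<Sum>i\<le>d. \<bar>C i\<bar>)"
    proof (rule sum_mono)
      fix i assume i: "i \<in> {..d}"
      have "truncated_norm r n (coeff Q i * u ^ i) \<le>
          truncated_norm r n (coeff Q i) * truncated_norm r n (u ^ i)"
        using r by (intro truncated_norm_mult) simp
      also have "\<dots> \<le> truncated_norm r n (coeff Q i) * truncated_norm r n u ^ i"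
        using r by (intro mult_left_mono truncated_norm_power truncated_norm_nonneg) auto
      also have "\<dots> \<le> truncated_norm r n (coeff Q i) * 1"
        using r Suc by (intro mult_left_mono power_le_one truncated_norm_nonneg) auto
      also have "\<dots> \<le> C i" using C[of r i n] rR i r by simp
      finally show "truncated_norm r n (coeff Q i * u ^ i) \<le> \<bar>C i\<bar>" by simp
    qed
    also have "\<dots> \<le> K" by (simp add: K_def)
    finally have "r * truncated_norm r n (poly Q u) \<le> r * K" using r by simp
    moreover have "truncated_norm r (Suc n) u = r * truncated_norm r n (poly Q u)"
      by (subst u) (rule truncated_norm_X_mult)
    ultimately show ?case using rK by simp
  qed
  have "norm (fps_nth u n) * r ^ n \<le> 1" for n
  proof -
    have "norm (fps_nth u n) * r ^ n \<le> truncated_norm r n u"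
      unfolding truncated_norm_def using r by (intro member_le_sum) auto
    then show ?thesis using bound[of n] by simp
  qed
  then show ?thesis using r by (rule fps_conv_radius_pos_if_bounded[rotated])
qed

text \<open>Beyond the constant term, integration divides coefficients by positive integers and so
  does not enlarge them; the index shift costs one factor \<open>r\<close>.\<close>

lemma fps_conv_radius_pos_if_deriv:
  fixes u :: "complex fps"
  assumes "fps_conv_radius (fps_deriv u) > 0"
  shows "fps_conv_radius u > 0"
proof -
  obtain r C where r: "r > 0" and C: "\<And>n s. 0 \<le> s \<Longrightarrow> s \<le> r \<Longrightarrow> truncated_norm s n (fps_deriv u) \<le> C"
    using truncated_norm_bounded[OF assms] by auto
  have "norm (fps_nth u n) * r ^ n \<le> max (norm (fps_nth u 0)) (r * C)" for n
  proof (cases n)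
    case (Suc m)
    have "1 * norm (fps_nth u n) \<le> real n * norm (fps_nth u n)"
      using Suc by (intro mult_right_mono) auto
    also have "\<dots> = norm (fps_nth (fps_deriv u) m)" by (simp add: Suc norm_mult del: of_nat_Suc)
    finally have "norm (fps_nth u n) * r ^ m \<le> norm (fps_nth (fps_deriv u) m) * r ^ m"
      using r by (intro mult_right_mono) auto
    also have "\<dots> \<le> truncated_norm r m (fps_deriv u)"
      unfolding truncated_norm_def using r by (intro member_le_sum) auto
    also have "\<dots> \<le> C" using C[of r m] r by simp
    finally have "r * (norm (fps_nth u n) * r ^ m) \<le> r * C" using r by simp
    then show ?thesis by (simp add: Suc mult_ac)
  qed simp
  then show ?thesis using r by (rule fps_conv_radius_pos_if_bounded[rotated])
qed

text \<open>The function \<open>h\<close> defined by \<open>T\<close> is injective near 0. The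
  expansion \<open>G\<close> of its holomorphic inverse satisfies \<open>G \<circ> T = X\<close>,
  which identifies it with the formal inverse.\<close>

lemma fps_conv_radius_pos_inv:
  fixes T :: "complex fps"
  assumes T: "fps_nth T 0 = 0" "fps_nth T 1 \<noteq> 0" and conv: "fps_conv_radius T > 0"
  shows "fps_conv_radius (fps_inv T) > 0"
proof -
  define h where "h = eval_fps T"
  have h: "h has_fps_expansion T" unfolding h_def by (rule eval_fps_has_fps_expansion[OF conv])
  have h0: "h 0 = 0" using T(1) by (simp add: h_def eval_fps_at_0)
  have "deriv h 0 = fps_nth T 1"
    using fps_nth_fps_expansion[OF h, of 1] by simp
  then have d: "deriv h 0 \<noteq> 0" using T(2) by simp
  have "h analytic_on {0}" using h by (rule has_fps_expansion_imp_analytic_0)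
  then obtain e where e: "e > 0" "h holomorphic_on ball 0 e" by (auto simp: analytic_on_def)
  obtain r where r: "r > 0" "ball (0::complex) r \<subseteq> ball 0 e" "inj_on h (ball 0 r)"
    by (rule has_complex_derivative_locally_injective[OF e(2) _ open_ball d]) (simp add: e(1))
  have hol: "h holomorphic_on ball 0 r" using e(2) r(2) by (rule holomorphic_on_subset)
  obtain g where g: "g holomorphic_on h ` ball 0 r" "\<And>z. z \<in> ball 0 r \<Longrightarrow> g (h z) = z"
    using holomorphic_has_inverse[OF hol open_ball r(3)] by metis
  have op: "open (h ` ball 0 r)" by (rule open_mapping_thm3[OF hol open_ball r(3)])
  have "0 \<in> h ` ball 0 r" using h0 r(1) by (intro image_eqI[of _ _ 0]) auto
  then have "g analytic_on {0}" using g(1) op by (auto simp: analytic_at)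
  then obtain G where G: "g has_fps_expansion G"
    using analytic_at_imp_has_fps_expansion_0 by blast
  have "(g \<circ> h) has_fps_expansion fps_compose G T"
    by (rule has_fps_expansion_compose[OF G h T(1)])
  moreover have "eventually (\<lambda>z. z \<in> ball 0 r) (nhds (0::complex))"
    using r(1) by (intro eventually_nhds_in_open) auto
  then have "eventually (\<lambda>z. (g \<circ> h) z = z) (nhds 0)"
    by eventually_elim (simp add: g(2))
  ultimately have "(\<lambda>z. z) has_fps_expansion fps_compose G T"
    by (subst (asm) has_fps_expansion_cong[OF _ refl])
  then have GT: "fps_compose G T = fps_X"
    using has_fps_expansion_fps_X fps_expansion_unique_complex by blast
  have "fps_compose (fps_inv T) T = fps_X" using T by (rule fps_inv)
  with GT have "fps_inv T = G" using fps_compose_inj_right[OF T, of "fps_inv T" G] by simp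
  then show ?thesis using G by (simp add: has_fps_expansion_def)
qed

section \<open>Algebraic Laurent series are convergent\<close>

text \<open>Used for convergent power series and for convergent Laurent series; \<open>polys\<close>
  collects the polynomials with coefficients in the subring.\<close>

locale subring =
  fixes K :: "'a::idom set"
  assumes zero: "0 \<in> K" and one: "1 \<in> K" and add: "a \<in> K \<Longrightarrow> b \<in> K \<Longrightarrow> a + b \<in> K"
    and mult: "a \<in> K \<Longrightarrow> b \<in> K \<Longrightarrow> a * b \<in> K" and uminus: "a \<in> K \<Longrightarrow> - a \<in> K"
begin

lemma diff: "a \<in> K \<Longrightarrow> b \<in> K \<Longrightarrow> a - b \<in> K"
  using add[of a "- b"] uminus[of b] by simp

lemma sum: "(\<And>i. i \<in> A \<Longrightarrow> f i \<in> K) \<Longrightarrow> (\<Sum>i\<in>A. f i) \<in> K"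
  by (induction A rule: infinite_finite_induct) (auto simp: zero add)

lemma power: "a \<in> K \<Longrightarrow> a ^ k \<in> K"
  by (induction k) (auto simp: one mult)

definition polys :: "'a poly set" where
  "polys = {p. \<forall>i. coeff p i \<in> K}"

lemma polysI: "(\<And>i. coeff p i \<in> K) \<Longrightarrow> p \<in> polys"
  and polysD: "p \<in> polys \<Longrightarrow> coeff p i \<in> K"
  by (auto simp: polys_def)

lemma polys_0: "0 \<in> polys"
  by (simp add: polys_def zero)

lemma polys_pCons: "a \<in> K \<Longrightarrow> p \<in> polys \<Longrightarrow> pCons a p \<in> polys"
  by (auto simp: polys_def coeff_pCons split: nat.splits)

lemma polys_add: "p \<in> polys \<Longrightarrow> q \<in> polys \<Longrightarrow> p + q \<in> polys"
  by (simp add: polys_def add)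

lemma polys_diff: "p \<in> polys \<Longrightarrow> q \<in> polys \<Longrightarrow> p - q \<in> polys"
  by (simp add: polys_def diff)

lemma polys_smult: "a \<in> K \<Longrightarrow> p \<in> polys \<Longrightarrow> smult a p \<in> polys"
  by (simp add: polys_def mult)

lemma polys_mult: "p \<in> polys \<Longrightarrow> q \<in> polys \<Longrightarrow> p * q \<in> polys"
  by (auto simp: polys_def coeff_mult intro!: sum mult)

lemma polys_sum: "(\<And>i. i \<in> A \<Longrightarrow> f i \<in> polys) \<Longrightarrow> (\<Sum>i\<in>A. f i) \<in> polys"
  by (induction A rule: infinite_finite_induct) (auto simp: polys_0 polys_add)

lemma polys_prod: "(\<And>i. i \<in> A \<Longrightarrow> f i \<in> polys) \<Longrightarrow> (\<Prod>i\<in>A. f i) \<in> polys"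
  by (induction A rule: infinite_finite_induct)
     (auto simp: polys_mult one_pCons intro!: polys_pCons one polys_0)

lemma polys_pcompose_linear: "p \<in> polys \<Longrightarrow> a \<in> K \<Longrightarrow> pcompose p [:0, a:] \<in> polys"
  by (simp add: polys_def coeff_pcompose_linear mult power)

lemma polys_pderiv: "p \<in> polys \<Longrightarrow> pderiv p \<in> polys"
proof (rule polysI)
  fix i assume "p \<in> polys"
  moreover have "of_nat k \<in> K" for k by (induction k) (auto simp: zero one add)
  ultimately show "coeff (pderiv p) i \<in> K"
    unfolding coeff_pderiv by (intro mult polysD)
qed

lemma poly_in: "p \<in> polys \<Longrightarrow> a \<in> K \<Longrightarrow> poly p a \<in> K"
  unfolding poly_altdef by (intro sum mult power polysD)

text \<open>One remainder \<open>R\<close> over \<open>K\<close> serves all \<open>h\<close>,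
  including those outside \<open>K\<close>: the increment will be a series whose convergence is
  still unknown.\<close>

lemma taylor_two:
  assumes "p \<in> polys" "a \<in> K"
  shows "\<exists>R\<in>polys. \<forall>h. poly p (a + h) = poly p a + poly (pderiv p) a * h + h\<^sup>2 * poly R h"
  using assms(1)
proof (induction p)
  case 0
  then show ?case by (intro bexI[of _ 0]) auto
next
  case (pCons c p)
  have p: "p \<in> polys"
  proof (rule polysI)
    show "coeff p i \<in> K" for i using polysD[OF pCons.prems, of "Suc i"] by simp
  qed
  obtain R where R: "R \<in> polys"
    "\<And>h. poly p (a + h) = poly p a + poly (pderiv p) a * h + h\<^sup>2 * poly R h"
    using pCons.IH[OF p] by blast
  show ?case
  proof (rule bexI[of _ "[:poly (pderiv p) a:] + smult a R + pCons 0 R"], rule allI)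
    show "[:poly (pderiv p) a:] + smult a R + pCons 0 R \<in> polys"
      by (intro polys_add polys_pCons polys_smult polys_0 zero R(1) assms(2) poly_in polys_pderiv p)
    fix h
    show "poly (pCons c p) (a + h) = poly (pCons c p) a + poly (pderiv (pCons c p)) a * h +
        h\<^sup>2 * poly ([:poly (pderiv p) a:] + smult a R + pCons 0 R) h"
      by (simp add: R(2) pderiv_pCons algebra_simps power2_eq_square)
  qed
qed

end

section \<open>Algebraic power series\<close>

definition convergent_fps :: "complex fps set" where
  "convergent_fps = {u. fps_conv_radius u > 0}"

interpretation fps: subring convergent_fps
proof
  fix a b assume "a \<in> convergent_fps" "b \<in> convergent_fps"
  then show "a + b \<in> convergent_fps" "a * b \<in> convergent_fps"
    using fps_conv_radius_add[of a b] fps_conv_radius_mult[of a b]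
    by (auto simp: convergent_fps_def min_def split: if_splits)
qed (auto simp: convergent_fps_def)

lemma convergent_fps_shift: "u \<in> convergent_fps \<Longrightarrow> fps_shift n u \<in> convergent_fps"
  by (simp add: convergent_fps_def)

lemma convergent_fps_X: "fps_X \<in> convergent_fps"
  by (simp add: convergent_fps_def)

lemma convergent_fps_cutoff: "fps_cutoff n u \<in> convergent_fps"
proof -
  have "norm (fps_nth (fps_cutoff n u) i) * 1 ^ i \<le> (\<Sum>j<n. norm (fps_nth u j))" for i
    by (auto simp: sum_nonneg intro: member_le_sum[of i "{..<n}" "\<lambda>j. norm (fps_nth u j)"])
  then have "fps_conv_radius (fps_cutoff n u) > 0"
    by (rule fps_conv_radius_pos_if_bounded[OF zero_less_one])
  then show ?thesis by (simp add: convergent_fps_def)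
qed

text \<open>Newton's method: with \<nu> the order of \<open>P'(y)\<close>, write
  \<open>y = a + X ^ (\<nu> + 1) * u\<close>, where \<open>a\<close> is a Taylor polynomial and
  \<open>u\<close> has no constant term. Taylor's formula at \<open>a\<close> then turns into
  \<open>u = X * Q(u)\<close> with convergent coefficients.\<close>

lemma convergent_fps_simple_root:
  assumes P: "P \<in> fps.polys" and root: "poly P y = 0" and simple: "poly (pderiv P) y \<noteq> 0"
  shows "y \<in> convergent_fps"
proof -
  define \<nu> where "\<nu> = subdegree (poly (pderiv P) y)"
  define a where "a = fps_cutoff (\<nu> + 2) y"
  define u where "u = fps_X * fps_shift (\<nu> + 2) y"
  define h where "h = fps_X ^ (\<nu> + 1) * u"
  have a: "a \<in> convergent_fps" unfolding a_def by (rule convergent_fps_cutoff)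
  have h_eq: "h = fps_X ^ (\<nu> + 2) * fps_shift (\<nu> + 2) y"
    unfolding h_def u_def by (simp add: mult_ac)
  have y: "y = a + h" unfolding a_def h_eq
    using fps_shift_cutoff'[of "\<nu> + 2" y] by (simp only: add.commute)
  obtain R where R: "R \<in> fps.polys"
    "\<And>h. poly P (a + h) = poly P a + poly (pderiv P) a * h + h\<^sup>2 * poly R h"
    using fps.taylor_two[OF P a] by blast
  obtain R' where R': "\<And>h. poly (pderiv P) (a + h) =
      poly (pderiv P) a + poly (pderiv (pderiv P)) a * h + h\<^sup>2 * poly R' h"
    using fps.taylor_two[OF fps.polys_pderiv[OF P] a] by blast
  define D where "D = poly (pderiv P) a"
  have D_eq: "D = poly (pderiv P) y - fps_X ^ (\<nu> + 2) *
      (fps_shift (\<nu> + 2) y * (poly (pderiv (pderiv P)) a + h * poly R' h))"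
    using R'[of h] unfolding y[symmetric] D_def
    by (simp add: h_eq power2_eq_square algebra_simps)
  \<comment> \<open>As \<open>y - a\<close> is divisible by \<open>X ^ (\<nu> + 2)\<close>,
    \<open>D\<close> has the same order \<nu> as \<open>P'(y)\<close>, and \<open>B\<close> is its
    unit part.\<close>
  have D_nth: "fps_nth D i = fps_nth (poly (pderiv P) y) i" if "i < \<nu> + 2" for i
    unfolding D_eq fps_sub_nth fps_X_power_mult_nth using that by simp
  define B where "B = fps_shift \<nu> D"
  have "fps_nth D i = 0" if "i < \<nu>" for i
    using D_nth[of i] that nth_less_subdegree_zero[of i "poly (pderiv P) y"] by (simp add: \<nu>_def)
  then have DB: "D = fps_X ^ \<nu> * B" unfolding B_def
    by (intro fps_ext) (auto simp: fps_X_power_mult_nth)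
  have B0: "fps_nth B 0 \<noteq> 0" using D_nth[of \<nu>] simple by (simp add: B_def \<nu>_def)
  have "D \<in> convergent_fps" unfolding D_def by (intro fps.poly_in fps.polys_pderiv P a)
  then have B: "B \<in> convergent_fps" unfolding B_def by (rule convergent_fps_shift)
  have invB: "inverse B \<in> convergent_fps"
    using B fps_conv_radius_inverse_pos[OF B0] by (simp add: convergent_fps_def)
  define W where "W = u\<^sup>2 * poly R h"
  \<comment> \<open>The linear term \<open>D * h\<close> contributes \<nu> and \<nu> + 1 factors
    \<open>X\<close>. The quadratic term contributes 2\<nu> + 2, so dividing leaves it one factor
    \<open>X\<close>.\<close>
  have X_pow: "fps_X ^ (2 * \<nu> + 1) = (fps_X ^ \<nu> * fps_X ^ (\<nu> + 1) :: complex fps)"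
    by (simp only: mult_2 add.assoc power_add)
  have "0 = poly P a + D * h + h\<^sup>2 * poly R h"
    using root R(2)[of h] unfolding y[symmetric] by (simp add: D_def)
  also have "D * h = fps_X ^ (2 * \<nu> + 1) * (B * u)"
    unfolding DB h_def X_pow by (simp only: mult_ac)
  also have "h\<^sup>2 * poly R h = fps_X ^ (2 * \<nu> + 1) * (fps_X * W)"
    unfolding h_def W_def X_pow unfolding power2_eq_square power_add power_one_right
    by (simp only: mult_ac)
  finally have "poly P a + fps_X ^ (2 * \<nu> + 1) * (B * u + fps_X * W) = 0"
    by (simp only: distrib_left add.assoc)
  then have Pa: "- poly P a = fps_X ^ (2 * \<nu> + 1) * (B * u + fps_X * W)"
    by (rule minus_unique)
  define A where "A = fps_shift (2 * \<nu> + 1) (- poly P a)"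
  have A_eq: "A = B * u + fps_X * W"
    unfolding A_def Pa mult.commute[of "fps_X ^ (2 * \<nu> + 1)"] by (rule fps_shift_times_fps_X_power')
  have A: "A \<in> convergent_fps" unfolding A_def
    by (intro convergent_fps_shift fps.uminus fps.poly_in P a)
  have A0: "fps_nth A 0 = 0" unfolding A_eq u_def by simp
  have AX: "A = fps_X * fps_shift 1 A"
  proof (rule fps_ext)
    show "fps_nth A n = fps_nth (fps_X * fps_shift 1 A) n" for n
      by (cases n) (simp_all add: A0)
  qed
  have "B * u = fps_X * (fps_shift 1 A - W)"
    using A_eq AX by (simp add: algebra_simps)
  then have "inverse B * (B * u) = fps_X * (inverse B * (fps_shift 1 A - W))"
    by (simp add: mult_ac)
  moreover have "inverse B * (B * u) = u"
    using inverse_mult_eq_1[OF B0] by (simp flip: mult.assoc)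
  ultimately have u_eq: "u = fps_X * (inverse B * (fps_shift 1 A - W))" by simp
  \<comment> \<open>The substitution \<open>h = X ^ (\<nu> + 1) * u\<close> makes the remainder a
    polynomial in \<open>u\<close>.\<close>
  define S where "S = pcompose R [:0, fps_X ^ (\<nu> + 1):]"
  define Q where "Q = smult (inverse B) ([:fps_shift 1 A:] - pCons 0 (pCons 0 S))"
  have "S \<in> fps.polys" unfolding S_def
    by (intro fps.polys_pcompose_linear R(1) fps.power convergent_fps_X)
  then have "Q \<in> fps.polys" unfolding Q_def
    by (intro fps.polys_smult invB fps.polys_diff fps.polys_pCons fps.polys_0 fps.zero
      convergent_fps_shift A)
  moreover have "poly S u = poly R h" by (simp add: S_def poly_pcompose h_def mult.commute)
  then have "poly Q u = inverse B * (fps_shift 1 A - W)"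
    by (simp add: Q_def W_def power2_eq_square algebra_simps)
  with u_eq have "u = fps_X * poly Q u" by simp
  ultimately have "u \<in> convergent_fps"
    using fps_conv_radius_contraction_fixpoint[of u Q] fps.polysD[of Q]
    by (simp add: convergent_fps_def)
  then show ?thesis unfolding y h_def by (intro fps.add a fps.mult fps.power convergent_fps_X)
qed

text \<open>For an annihilating polynomial of least degree, the nonzero derivative has smaller
  degree and cannot vanish at \<open>y\<close>, so the root is simple.\<close>

lemma convergent_fps_algebraic:
  assumes "P \<in> fps.polys" "P \<noteq> 0" "poly P y = 0"
  shows "y \<in> convergent_fps"
proof -
  define Z where "Z = (\<lambda>P. P \<in> fps.polys \<and> P \<noteq> 0 \<and> poly P y = 0)"
  have "Z P" using assms by (simp add: Z_def)
  then obtain P where P: "Z P" and min: "\<And>P'. Z P' \<Longrightarrow> degree P \<le> degree P'"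
    using ex_has_least_nat[of Z P degree] by blast
  have "degree P \<noteq> 0"
  proof
    assume "degree P = 0"
    then obtain c where "P = [:c:]" by (rule degree_eq_zeroE)
    then show False using P by (simp add: Z_def)
  qed
  then have "pderiv P \<noteq> 0" "degree (pderiv P) < degree P"
    by (simp_all add: pderiv_eq_0_iff degree_pderiv)
  then have "\<not> Z (pderiv P)" using min[of "pderiv P"] by linarith
  then have "poly (pderiv P) y \<noteq> 0"
    using P \<open>pderiv P \<noteq> 0\<close> fps.polys_pderiv by (auto simp: Z_def)
  then show ?thesis using convergent_fps_simple_root[of P y] P by (simp add: Z_def)
qed

section \<open>Algebraic Laurent series\<close>

definition convergent_fls :: "complex fls set" where
  "convergent_fls = {f. laurent_convergent f}"

lemma convergent_fls_iff: "f \<in> convergent_fls \<longleftrightarrow> fls_conv_radius f > 0"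
  by (simp add: convergent_fls_def laurent_convergent_iff)

interpretation fls: subring convergent_fls
proof
  fix a b assume "a \<in> convergent_fls" "b \<in> convergent_fls"
  then show "a + b \<in> convergent_fls" "a * b \<in> convergent_fls"
    using fls_conv_radius_add[of a b] fls_conv_radius_mult[of a b]
    by (auto simp: convergent_fls_iff min_def split: if_splits)
qed (auto simp: convergent_fls_iff)

lemma convergent_fls_const: "fls_const c \<in> convergent_fls"
  and convergent_fls_X_intpow: "fls_X_intpow k \<in> convergent_fls"
  by (simp_all add: convergent_fls_iff)

lemma convergent_fls_inverse: "f \<in> convergent_fls \<Longrightarrow> inverse f \<in> convergent_fls"
  unfolding convergent_fls_iff
  using has_laurent_expansion_inverse[OF eval_fls_has_laurent_expansion, of f]
  by (simp add: has_laurent_expansion_def)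

lemma convergent_fls_powi: "f \<in> convergent_fls \<Longrightarrow> f powi k \<in> convergent_fls"
  by (auto simp: power_int_def intro!: fls.power convergent_fls_inverse)

lemma fps_to_fls_sum: "fps_to_fls (\<Sum>i\<in>A. g i) = (\<Sum>i\<in>A. fps_to_fls (g i))"
  by (induction A rule: infinite_finite_induct) (simp_all add: fps_to_fls_plus)

text \<open>Poles are cleared: \<open>y0 = X ^ m * y\<close> is a power series and a root of the
  polynomial with coefficients \<open>X ^ (L - i * m) * coeff P i\<close>, whose value at
  \<open>y0\<close> is \<open>X ^ L * P(y)\<close>.\<close>

lemma convergent_fls_algebraic:
  assumes P: "P \<in> fls.polys" "P \<noteq> 0" and root: "poly P y = 0"
  shows "y \<in> convergent_fls"
proof -
  define m where "m = nat (- fls_subdegree y)"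
  define d where "d = degree P"
  \<comment> \<open>The sum outweighs the pole of each coefficient, and \<open>d * m\<close>
    compensates the shifts by \<open>i * m\<close>.\<close>
  define L where "L = (\<Sum>i\<le>d. nat (- fls_subdegree (coeff P i))) + d * m"
  define y0 where "y0 = fls_regpart (fls_X_intpow (int m) * y)"
  define c where "c = (\<lambda>i. fls_regpart (fls_X_intpow (int L - int (i * m)) * coeff P i))"
  have X_mult_nonneg: "fps_to_fls (fls_regpart (fls_X_intpow k * g)) = fls_X_intpow k * g"
    if "k + fls_subdegree g \<ge> 0" for k and g :: "complex fls"
    by (rule fls_regpart_to_fls_trivial)
       (use that in \<open>cases "g = 0"; auto simp: fls_subdegree_mult\<close>)
  have y0: "fps_to_fls y0 = fls_X_intpow (int m) * y"
    unfolding y0_def by (rule X_mult_nonneg) (simp add: m_def)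
  have c: "fps_to_fls (c i) = fls_X_intpow (int L - int (i * m)) * coeff P i" if "i \<le> d" for i
    unfolding c_def
  proof (rule X_mult_nonneg)
    have "nat (- fls_subdegree (coeff P i)) \<le> (\<Sum>i\<le>d. nat (- fls_subdegree (coeff P i)))"
      using that by (intro member_le_sum) auto
    moreover have "i * m \<le> d * m" using that by simp
    ultimately show "int L - int (i * m) + fls_subdegree (coeff P i) \<ge> 0"
      unfolding L_def by linarith
  qed
  define Q where "Q = (\<Sum>i\<le>d. monom (c i) i)"
  have coeff_Q: "coeff Q i = (if i \<le> d then c i else 0)" for i
    by (simp add: Q_def coeff_sum)
  have "c i \<in> convergent_fps" for i
  proof -
    have "fls_X_intpow (int L - int (i * m)) * coeff P i \<in> convergent_fls"
      by (intro fls.mult convergent_fls_X_intpow fls.polysD P(1))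
    then show ?thesis by (simp add: c_def convergent_fps_def convergent_fls_iff fls_conv_radius_def)
  qed
  then have "Q \<in> fps.polys" by (intro fps.polysI) (simp add: coeff_Q fps.zero)
  moreover have "Q \<noteq> 0"
  proof
    assume "Q = 0"
    then have "fps_to_fls (c d) = 0" using coeff_Q[of d] by simp
    then have "coeff P d = 0"
      unfolding c[OF order.refl] mult_eq_0_iff using fls_X_intpow_nonzero by blast
    then show False using P(2) by (simp add: d_def)
  qed
  moreover have "poly Q y0 = 0"
  proof -
    have "fps_to_fls (poly Q y0) = (\<Sum>i\<le>d. fps_to_fls (c i) * fps_to_fls y0 ^ i)"
      by (simp add: Q_def poly_sum poly_monom fls_times_fps_to_fls fps_to_fls_sum fps_to_fls_power)
    also have "\<dots> = (\<Sum>i\<le>d. fls_X_intpow (int L) * (coeff P i * y ^ i))"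
    proof (rule sum.cong[OF refl])
      fix i assume "i \<in> {..d}"
      then have i: "i \<le> d" by simp
      have "fps_to_fls (c i) * fps_to_fls y0 ^ i =
          (fls_X_intpow (int L - int (i * m)) * fls_X_intpow (int (i * m))) * (coeff P i * y ^ i)"
        unfolding c[OF i] y0 power_mult_distrib fls_X_intpow_power of_nat_mult
        by (simp only: mult_ac)
      also have "fls_X_intpow (int L - int (i * m)) * fls_X_intpow (int (i * m)) =
          (fls_X_intpow (int L) :: complex fls)"
        unfolding fls_X_intpow_times_fls_X_intpow by (simp only: diff_add_cancel)
      finally show "fps_to_fls (c i) * fps_to_fls y0 ^ i = fls_X_intpow (int L) * (coeff P i * y ^ i)" .
    qed
    also have "\<dots> = fls_X_intpow (int L) * poly P y"
      by (simp add: poly_altdef d_def sum_distrib_left)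
    finally show ?thesis using root by simp
  qed
  ultimately have "y0 \<in> convergent_fps" by (rule convergent_fps_algebraic)
  then have "fps_to_fls y0 \<in> convergent_fls" by (simp add: convergent_fps_def convergent_fls_iff)
  then have conv: "fls_X_intpow (- int m) * (fls_X_intpow (int m) * y) \<in> convergent_fls"
    unfolding y0 by (rule fls.mult[OF convergent_fls_X_intpow])
  have one: "fls_X_intpow (- int m) * fls_X_intpow (int m) = (1 :: complex fls)"
    unfolding fls_X_intpow_times_fls_X_intpow by simp
  have "fls_X_intpow (- int m) * (fls_X_intpow (int m) * y) = y"
    unfolding mult.assoc[symmetric] one by (rule mult_1_left)
  then show ?thesis using conv by (rule subst[of _ y "\<lambda>z. z \<in> convergent_fls"])
qed

section \<open>Composition with a local parameter\<close>

lemma fls_as_X_power_times_fps: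
  obtains k :: nat and u :: "'a::field fps" where "F = fls_X_inv ^ k * fps_to_fls u"
proof
  define k where "k = nat (- fls_subdegree F)"
  have "fps_to_fls (fls_regpart (fls_X ^ k * F)) = fls_X ^ k * F"
    by (rule fls_regpart_to_fls_trivial) (cases "F = 0"; simp add: k_def)
  moreover have "fls_X_inv ^ k * (fls_X ^ k * F) = F"
    by (simp add: power_inverse flip: fls_inverse_X)
  ultimately show "F = fls_X_inv ^ k * fps_to_fls (fls_regpart (fls_X ^ k * F))" by metis
qed

text \<open>By Leibniz's rule the chain rule passes to products. It holds for power series and for
  the inverse of \<open>X\<close>, whose powers multiplied by power series give every Laurent
  series.\<close>

lemma fls_deriv_compose_fps:
  fixes F :: "'a::field_char_0 fls"
  assumes H: "H \<noteq> 0" "fps_nth H 0 = 0"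
  shows "fls_deriv (fls_compose_fps F H) =
    fls_compose_fps (fls_deriv F) H * fps_to_fls (fps_deriv H)"
proof -
  let ?C = "\<lambda>F. fls_compose_fps F H"
  define D where "D = (\<lambda>F. fls_deriv (?C F) = ?C (fls_deriv F) * fps_to_fls (fps_deriv H))"
  have mult: "D (F * G)" if "D F" "D G" for F G
    using that H by (simp add: D_def fls_compose_fps_mult fls_compose_fps_add algebra_simps)
  have fps: "D (fps_to_fls u)" for u
    using H by (simp add: D_def fls_deriv_fps_to_fls fps_compose_deriv fls_times_fps_to_fls)
  have D1: "D 1" by (simp add: D_def)
  have "?C fls_X_inv = inverse (fps_to_fls H)"
    using fls_compose_fps_inverse[OF H, of fls_X] by (simp add: fls_inverse_X)
  then have inv: "D fls_X_inv"
    using H by (simp add: D_def fls_inverse_deriv fls_compose_fps_power fls_deriv_fps_to_fls)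
  have pow: "D (fls_X_inv ^ k)" for k
    by (induction k) (use D1 inv mult in auto)
  obtain k u where "F = fls_X_inv ^ k * fps_to_fls u" by (rule fls_as_X_power_times_fps)
  then have "D F" using mult[OF pow fps] by simp
  then show ?thesis by (simp add: D_def)
qed

interpretation fls_const: coefficient_map "fls_const :: complex \<Rightarrow> complex fls"
  by unfold_locales (simp_all add: fls_const_mult_const fls_plus_const)

text \<open>Composition with \<open>H\<close> is a ring homomorphism fixing constants, so algebraic
  relations survive a change of parameter.\<close>

lemma fls_compose_poly_eval:
  assumes H: "H \<noteq> 0" "fps_nth H 0 = 0"
  shows "fls_compose_fps (poly_eval fls_const w F) H =
    poly_eval fls_const (\<lambda>i. fls_compose_fps (w i) H) F"
  by (induction F rule: mpoly_induct)
     (simp_all add: fls_const.poly_eval_mconst fls_const.poly_eval_mvar fls_const.poly_eval_add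
       fls_const.poly_eval_mult fls_compose_fps_add[OF H] fls_compose_fps_mult[OF H])

lemma fps_root_exists:
  fixes h :: "complex fps"
  assumes "j > 0" "fps_nth h 0 \<noteq> 0"
  obtains g where "g ^ j = h" "fps_nth g 0 \<noteq> 0"
proof -
  obtain i where j: "j = Suc i" using assms(1) by (cases j) auto
  define z where "z = exp (Ln (fps_nth h 0) / of_nat j)"
  have z: "z ^ j = fps_nth h 0"
    using assms by (simp add: z_def exp_divide_power_eq)
  define g where "g = fps_radical (\<lambda>_ _. z) j h"
  have g: "g ^ j = h" unfolding g_def j
    using power_radical[of h "\<lambda>_ _. z" i] assms(2) z j by simp
  then have "fps_nth g 0 ^ j \<noteq> 0" using assms(2) by (metis fps_nth_power_0)
  then have "fps_nth g 0 \<noteq> 0" using assms(1) by (metis zero_power)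
  with g show thesis by (rule that)
qed

text \<open>After subtracting a constant the order \<open>k\<close> is nonzero, and the unit left
  after removing \<open>X ^ k\<close> has a \<open>k\<close>-th root. A negative \<open>k\<close>
  occurs when \<open>f\<close> has a pole.\<close>

lemma fls_local_parameter:
  fixes f :: "complex fls"
  assumes "\<And>c. f \<noteq> fls_const c"
  obtains c k s where "k \<noteq> 0" "fps_nth s 0 = 0" "fps_nth s 1 \<noteq> 0"
    "f = fls_const c + fps_to_fls s powi k"
proof -
  \<comment> \<open>If \<open>f\<close> has a pole, nothing is subtracted; the order is then
    negative already.\<close>
  define c where "c = (if fls_subdegree f \<ge> 0 then fls_nth f 0 else 0)"
  define g where "g = f - fls_const c"
  define k where "k = fls_subdegree g"
  have g: "g \<noteq> 0" using assms[of c] by (simp add: g_def)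
  have k: "k \<noteq> 0"
  proof
    assume "k = 0"
    then have g0: "fls_nth g 0 \<noteq> 0" using g nth_fls_subdegree_nonzero[of g] by (simp add: k_def)
    show False
    proof (cases "fls_subdegree f \<ge> 0")
      case True
      then show ?thesis using g0 by (simp add: g_def c_def)
    next
      case False
      then have "g = f" by (simp add: g_def c_def)
      then show ?thesis using False \<open>k = 0\<close> by (simp add: k_def)
    qed
  qed
  define h where "h = fls_base_factor_to_fps g"
  have h0: "fps_nth h 0 \<noteq> 0" unfolding h_def using g by (rule fls_base_factor_to_fps_base)
  have gh: "g = fls_X powi k * fps_to_fls h"
    using fls_conv_base_factor_to_fps_shift_subdegree[of g]
    by (simp add: k_def h_def fls_shifted_times_simps)
  \<comment> \<open>For negative \<open>k\<close>, the root of the inverse of \<open>h\<close> has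
    \<open>k\<close>-th power \<open>h\<close>.\<close>
  define h' where "h' = (if k > 0 then h else inverse h)"
  have "fps_nth h' 0 \<noteq> 0" using h0 by (simp add: h'_def)
  then obtain e where e: "e ^ nat \<bar>k\<bar> = h'" "fps_nth e 0 \<noteq> 0"
    using fps_root_exists[of "nat \<bar>k\<bar>" h'] k by auto
  define s where "s = fps_X * e"
  have "fps_to_fls e powi k = fps_to_fls h"
  proof (cases "k > 0")
    case True
    then have "fps_to_fls e powi k = fps_to_fls (e ^ nat \<bar>k\<bar>)"
      by (simp add: power_int_def fps_to_fls_power)
    then show ?thesis using True e(1) by (simp add: h'_def)
  next
    case False
    then have "fps_to_fls e powi k = inverse (fps_to_fls (e ^ nat \<bar>k\<bar>))"
      using k by (simp add: power_int_def fps_to_fls_power power_inverse)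
    also have "\<dots> = inverse (fps_to_fls (inverse h))" using False e(1) by (simp add: h'_def)
    also have "\<dots> = fps_to_fls h"
      using h0 by (intro inverse_unique)
        (simp flip: fls_times_fps_to_fls add: inverse_mult_eq_1)
    finally show ?thesis .
  qed
  then have "fps_to_fls s powi k = g"
    by (simp add: s_def gh fls_times_fps_to_fls power_int_mult_distrib)
  then have "f = fls_const c + fps_to_fls s powi k" by (simp add: g_def)
  then show thesis using that[OF k, of s c] e(2) by (simp add: s_def)
qed

text \<open>Both kinds of expansion point are unified by \<open>x - x0 = t powi \<nu>\<close> or
  \<open>x = t powi \<nu>\<close>, with \<nu> equal to \<open>n\<close> or
  \<open>- n\<close>.\<close>

lemma puiseux_deriv_eq:
  "\<exists>\<nu>::int. \<bar>\<nu>\<bar> = int n \<and> (\<forall>f. puiseux_deriv p n f =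
    fls_const (1 / of_int \<nu>) * fls_shift (\<nu> - 1) (fls_deriv f))"
proof (cases p)
  case (Finite x0)
  then show ?thesis by (intro exI[of _ "int n"]) simp
next
  case Infinity
  then show ?thesis by (intro exI[of _ "- int n"]) simp
qed

text \<open>Only the regular part matters, since a principal part is finite.\<close>

lemma convergent_fls_if_deriv:
  assumes "fls_deriv E \<in> convergent_fls"
  shows "E \<in> convergent_fls"
  using assms fps_conv_radius_pos_if_deriv[of "fls_regpart E"]
  by (simp add: convergent_fls_iff fls_conv_radius_def fps_deriv_fls_regpart)

text \<open>\<open>P\<close>, the kernel of evaluation at \<open>v\<close>, is prime because Laurent
  series form a field. \<open>K\<close> consists of the polynomials with nonzero convergent value,
  so the relation obtained with it is an algebraic equation for \<open>v 1\<close> over convergent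
  series.\<close>

lemma algebraic_derivative_convergent:
  fixes v :: "nat \<Rightarrow> complex fls"
  assumes dim: "dimension_one n (zero_set n S)" and n: "n \<ge> 2"
    and S: "\<And>F. F \<in> S \<Longrightarrow> poly_vars F \<subseteq> {..<n}" "\<And>F. F \<in> S \<Longrightarrow> poly_eval fls_const v F = 0"
    and v0: "v 0 \<in> convergent_fls" "\<And>c. v 0 \<noteq> fls_const c"
  shows "v 1 \<in> convergent_fls"
proof -
  define ev where "ev = poly_eval fls_const v"
  note ev_simps = fls_const.poly_eval_mconst fls_const.poly_eval_mvar fls_const.poly_eval_add
    fls_const.poly_eval_mult fls_const.poly_eval_diff fls_const.poly_eval_sum
    fls_const.poly_eval_prod fls_const.poly_eval_0 fls_const.poly_eval_1
  define P where "P = {F. ev F = 0}"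
  define K where "K = {F. ev F \<noteq> 0 \<and> ev F \<in> convergent_fls}"
  have P: "prime_ideal P"
    unfolding prime_ideal_def ideal_def P_def ev_def by (simp add: ev_simps)
  have PV: "prime_zeros n P \<subseteq> zero_set n S"
    using S by (auto simp: prime_zeros_def zero_set_def P_def ev_def)
  have K1: "1 \<in> K" by (simp add: K_def ev_def ev_simps fls.one)
  have K2: "s * t \<in> K" if "s \<in> K" "t \<in> K" for s t
    using that by (simp add: K_def ev_def ev_simps fls.mult)
  have PK: "P \<inter> K = {}" by (auto simp: P_def K_def)
  have K0: "mvar 0 - mconst c \<in> K" for c
    using v0 by (simp add: K_def ev_def ev_simps fls.diff convergent_fls_const)
  show ?thesis
  proof (rule dimension_one_relation[OF dim n P PV K1 K2 PK K0])
    fix c assume "mvar 1 - mconst c \<in> P"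
    then have "v 1 = fls_const c" by (simp add: P_def ev_def ev_simps)
    then show ?thesis by (simp add: convergent_fls_const)
  next
    fix B l s
    assume B: "finite B" "\<exists>c\<in>B. l c \<noteq> 0" "\<forall>c\<in>B. s c \<in> K"
      and rel: "(\<Sum>c\<in>B. mconst (l c) * s c * (\<Prod>k\<in>B - {c}. mvar 1 - mconst k)) \<in> P"
    \<comment> \<open>The relation is evaluated at \<open>v\<close>, with \<open>v 1\<close>
      replaced by an indeterminate.\<close>
    define p where "p = (\<Sum>c\<in>B. smult (fls_const (l c) * ev (s c))
      (\<Prod>k\<in>B - {c}. [:- fls_const k, 1:]))"
    have "poly p (v 1) = 0"
      using rel by (simp add: P_def ev_def ev_simps p_def poly_sum poly_prod)
    moreover have "p \<in> fls.polys"
      unfolding p_def using B(3)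
      by (intro fls.polys_sum fls.polys_smult fls.polys_prod fls.polys_pCons fls.polys_0
        fls.mult fls.uminus fls.one convergent_fls_const) (auto simp: K_def)
    moreover have "p \<noteq> 0"
    proof -
      obtain c where c: "c \<in> B" "l c \<noteq> 0" using B(2) by blast
      then have "fls_const (l c) * ev (s c) \<noteq> 0" using B(3) by (auto simp: K_def)
      moreover have "inj_on fls_const B" by (auto simp: inj_on_def dest: arg_cong[of _ _ "\<lambda>f. fls_nth f 0"])
      ultimately show ?thesis
        unfolding p_def by (intro lagrange_combination_nonzero[OF B(1) _ c(1)])
    qed
    ultimately show ?thesis by (intro convergent_fls_algebraic)
  qed
qed

theorem theorem3p4:
  fixes m M :: nat and F :: "nat \<Rightarrow> complex_mpoly"
    and p :: expansion_point and n :: nat and f :: "complex fls"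
  assumes "m > 0"
    and "\<And>j. j \<in> {1..M} \<Longrightarrow> poly_vars (F j) \<subseteq> {..<m + 1}"
    and "dimension_one (m + 1) (zero_set (m + 1) (F ` {1..M}))"
    and "n > 0"
    and "puiseux_solution M F p n f"
  shows "laurent_convergent f"
proof (cases "\<exists>c. f = fls_const c")
  case True
  then show ?thesis using convergent_fls_const by (auto simp: convergent_fls_def)
next
  case False
  then have nonconst: "f \<noteq> fls_const c" for c by blast
  obtain c k s where k: "k \<noteq> 0" and s: "fps_nth s 0 = 0" "fps_nth s 1 \<noteq> 0"
    and f: "f = fls_const c + fps_to_fls s powi k"
    by (rule fls_local_parameter[OF nonconst])
  define T where "T = fps_inv s"
  have T0: "fps_nth T 0 = 0" and T1: "fps_nth T 1 \<noteq> 0"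
    using s by (simp_all add: T_def fps_inv_def)
  have T: "T \<noteq> 0" using T1 by auto
  have sT: "fps_compose s T = fps_X" unfolding T_def using s by (rule fps_inv_right)
  let ?C = "\<lambda>g. fls_compose_fps g T"
  \<comment> \<open>In the parameter given by \<open>s\<close>, the series \<open>f\<close> becomes
    \<open>c + X powi k\<close>. The transformed derivatives still satisfy the system, although they
    need not be derivatives with respect to the new parameter.\<close>
  define v where "v = (\<lambda>i. ?C ((puiseux_deriv p n ^^ i) f))"
  have v0: "v 0 = fls_const c + fls_X_intpow k"
    using T T0 by (simp add: v_def f fls_compose_fps_add fls_compose_fps_powi sT)
  have v0_conv: "v 0 \<in> convergent_fls"
    unfolding v0 by (intro fls.add convergent_fls_const convergent_fls_X_intpow)
  have v0_const: "v 0 \<noteq> fls_const d" for d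
  proof
    assume "v 0 = fls_const d"
    then have "fls_nth (v 0) k = fls_nth (fls_const d) k" by simp
    then show False using k by (simp add: v0)
  qed
  have zero: "poly_eval fls_const v (F j) = 0" if "j \<in> {1..M}" for j
  proof -
    have "poly_eval fls_const (\<lambda>i. (puiseux_deriv p n ^^ i) f) (F j) = 0"
      using assms(5) that unfolding puiseux_solution_def by (rule bspec)
    then have "?C (poly_eval fls_const (\<lambda>i. (puiseux_deriv p n ^^ i) f) (F j)) = 0"
      by (simp only: fls_compose_fps_0)
    then show ?thesis unfolding fls_compose_poly_eval[OF T T0] v_def .
  qed
  have v1_conv: "v 1 \<in> convergent_fls"
  proof (rule algebraic_derivative_convergent[where v = v, OF assms(3) _ _ _ v0_conv v0_const])
    show "2 \<le> m + 1" using assms(1) by simp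
    fix G assume "G \<in> F ` {1..M}"
    then obtain j where j: "j \<in> {1..M}" "G = F j" by blast
    show "poly_vars G \<subseteq> {..<m + 1}" unfolding j(2) by (rule assms(2)[OF j(1)])
    show "poly_eval fls_const v G = 0" unfolding j(2) by (rule zero[OF j(1)])
  qed
  obtain \<nu> :: int where \<nu>: "\<bar>\<nu>\<bar> = int n"
    and D: "\<forall>g. puiseux_deriv p n g = fls_const (1 / of_int \<nu>) * fls_shift (\<nu> - 1) (fls_deriv g)"
    using puiseux_deriv_eq[of n p] by (elim exE conjE)
  have \<nu>0: "\<nu> \<noteq> 0" using \<nu> assms(4) by auto
  define t where "t = fps_to_fls T"
  have t: "t \<noteq> 0" using T by (simp add: t_def)
  define t' where "t' = fps_to_fls (fps_deriv T)"
  \<comment> \<open>\<open>E\<close> is the variable \<open>x\<close> (or \<open>x - x0\<close>)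
    written in the new parameter.\<close>
  define E where "E = t powi \<nu>"
  have chain: "fls_deriv (?C g) = ?C (fls_deriv g) * t'" for g
    unfolding t'_def by (rule fls_deriv_compose_fps[OF T T0])
  have v1: "v 1 = fls_const (1 / of_int \<nu>) * (?C (fls_deriv f) * t powi (1 - \<nu>))"
    using T T0 by (simp add: v_def D fls_compose_fps_mult fls_compose_fps_shift t_def)
  have C_X: "?C (fls_X_intpow i) = t powi i" for i
    using fls_compose_fps_powi[OF T T0, of fls_X i] by (simp add: t_def)
  have E': "fls_deriv E = of_int \<nu> * t powi (\<nu> - 1) * t'"
    unfolding E_def C_X[symmetric] chain fls_deriv_X_intpow fls_compose_fps_mult[OF T T0]
    by (simp only: fls_compose_fps_of_int)
  have f': "?C (fls_deriv f) * t' = of_int k * fls_X_intpow (k - 1)"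
    using chain[of f] v0 by (simp add: v_def fls_deriv_X_intpow)
  \<comment> \<open>By the chain rule, the relation \<open>v 1 = (D f) \<circ> T\<close> becomes a linear equation for
    the derivative of \<open>T\<^sup>\<nu>\<close>, with convergent coefficients.\<close>
  have E'_v1: "fls_deriv E * v 1 = of_int k * fls_X_intpow (k - 1)"
  proof -
    have "fls_deriv E * v 1 = (of_int \<nu> * fls_const (1 / of_int \<nu>)) *
        (t powi (\<nu> - 1) * t powi (1 - \<nu>)) * (?C (fls_deriv f) * t')"
      unfolding E' v1 by (simp only: mult_ac)
    also have "of_int \<nu> * fls_const (1 / of_int \<nu>) = (1 :: complex fls)"
      using \<nu>0 by (simp add: fls_of_int)
    also have "t powi (\<nu> - 1) * t powi (1 - \<nu>) = 1"
      using t by (simp flip: power_int_add)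
    finally show ?thesis using f' by simp
  qed
  moreover have "of_int k * fls_X_intpow (k - 1) \<noteq> (0 :: complex fls)"
    using k fls_X_intpow_nonzero unfolding mult_eq_0_iff of_int_eq_0_iff by blast
  ultimately have "v 1 \<noteq> 0" by auto
  then have "fls_deriv E = fls_deriv E * v 1 * inverse (v 1)" by simp
  also have "\<dots> = of_int k * fls_X_intpow (k - 1) * inverse (v 1)" by (simp only: E'_v1)
  also have "\<dots> = fls_const (of_int k) * fls_X_intpow (k - 1) * inverse (v 1)"
    by (simp add: fls_of_int)
  also have "\<dots> \<in> convergent_fls"
    by (intro fls.mult convergent_fls_const convergent_fls_X_intpow convergent_fls_inverse v1_conv)
  finally have E_conv: "E \<in> convergent_fls" by (rule convergent_fls_if_deriv)
  define e where "e = (if \<nu> > 0 then E else inverse E)"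
  have "t ^ n = e"
    using \<nu> \<nu>0 t by (auto simp: e_def E_def power_int_def power_inverse)
  \<comment> \<open>Convergence of \<open>t\<close> follows from that of its \<open>n\<close>-th
    power, since \<open>t\<close> is algebraic over the convergent series; inverting
    \<open>T\<close> then gives \<open>s\<close>.\<close>
  have "monom 1 n - [:e:] \<in> fls.polys"
    using E_conv convergent_fls_inverse
    by (intro fls.polys_diff fls.polys_pCons fls.polys_0 fls.polysI) (auto simp: e_def fls.zero fls.one)
  moreover have "coeff (monom 1 n - [:e:]) n \<noteq> 0" using assms(4) by (cases n) auto
  then have "monom 1 n - [:e:] \<noteq> 0" by (metis coeff_0)
  moreover have "poly (monom 1 n - [:e:]) t = 0" using \<open>t ^ n = e\<close> by (simp add: poly_monom)
  ultimately have "t \<in> convergent_fls" by (rule convergent_fls_algebraic)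
  then have "fps_conv_radius T > 0" by (simp add: t_def convergent_fls_iff)
  then have "fps_conv_radius s > 0"
    using fps_conv_radius_pos_inv[OF T0 T1] s by (simp add: T_def fps_inv_idempotent)
  then have "fps_to_fls s powi k \<in> convergent_fls"
    by (intro convergent_fls_powi) (simp add: convergent_fls_iff)
  then have "f \<in> convergent_fls" unfolding f by (intro fls.add convergent_fls_const)
  then show ?thesis by (simp add: convergent_fls_def)
qed

end
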